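(* For every $\mathbf b\in\mathrm{Comp}_{p,n}$ and every $h\in\mathcal H_{d,\mathbf b}$, $$\mathrm{Tr}\big(v_{\mathbf b}\,\Theta_{\mathbf b}(h)\,T_{\mathbf b}\big)=\mathrm{Tr}_{\mathbf b}(h)\,\mathrm{Tr}(v_{\mathbf b}T_{\mathbf b}).$$
   Context: Fix integers $p>1$, $d\ge1$, $n\ge3$, $r=pd$; $R$ a commutative ring with a primitive $p$th root of unity $\varepsilon$; $q,Q_1,\dots,Q_d\in R$ invertible, $\mathbf Q=(Q_1,\dots,Q_d)$. For a tuple $\mathbf Q'$ of $s$ units, $\mathcal H_{s,m}(\mathbf Q')$ is the Ariki–Koike algebra with parameters $q,\mathbf Q'$ (generators $T_0,\dots,T_{m-1}$, relations $\prod_i(T_0-Q'_i)=0$, $(T_i-q)(T_i+1)=0$, $T_0T_1T_0T_1=T_1T_0T_1T_0$, type A braid relations), with Jucys–Murphy elements $L_1=T_0$, $L_{k+1}=q^{-1}T_kL_kT_k$, elements $T_w$ ($w\in\mathfrak S_m$, via reduced expressions) and $R$-basis $\{L_1^{a_1}\cdots L_m^{a_m}T_w:0\le a_j<s,w\in\mathfrak S_m\}$. $\mathcal H_{r,n}=\mathcal H_{r,n}(\varepsilon Q_1,\dots,\varepsilon Q_d,\dots,\varepsilon^pQ_1,\dots,\varepsilon^pQ_d)$. $\mathrm{Tr}:\mathcal H_{r,n}\to R$ is the $R$-linear map with $\mathrm{Tr}(L_1^{a_1}\cdots L_n^{a_n}T_w)=1$ if all $a_j=0$ and $w=1$, and $0$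 otherwise ($0\le a_j<r$). In $\mathcal H_{r,n}$: $L^{(s)}_k=\prod_{i=1}^d(L_k-\varepsilon^sQ_i)$; $L^{(i,j)}_{l,m}=\prod_{k=l}^m\prod_{s\in I_{ij}}L^{(s)}_k$ with $I_{ij}=\{i,\dots,j\}$ ($i\le j$) or $\{1,\dots,j\}\cup\{i,\dots,p\}$ ($i>j$), superscripts mod $p$, $L^{(s)}_{l,m}=L^{(s,s)}_{l,m}$, empty products $1$; $w_{a,b}=(s_{a+b-1}\cdots s_1)^b$, $w^{\langle k\rangle}_{a,b}=(s_{a+b+k-1}\cdots s_{k+1})^b$, $T_{a,b}=T_{w_{a,b}}$. $\mathrm{Comp}_{p,n}$: compositions $\mathbf b=(b_1,\dots,b_p)$ of $n$ into $p$ nonnegative parts; $\mathbf b_i^j=b_i+\dots+b_j$ ($i\le j$), $0$ otherwise. $v_{\mathbf b}=L^{(1,p-1)}_{1,b_p}T_{b_p,\mathbf b_1^{p-1}}\cdots L^{(1,1)}_{1,b_2}T_{b_2,\mathbf b_1^1}\cdot L^{(2)}_{1,\mathbf b_1^1}\cdots L^{(p)}_{1,\mathbf b_1^{p-1}}$; $w_{\mathbf b}=w^{\langle\mathbf b_1^{p-2}\rangle}_{b_{p-1},\mathbf b_p^p}\cdots w^{\langle\mathbf b_1^1\rangle}_{b_2,\mathbf b_3^p}w_{b_1,\mathbf b_2^p}$, $T_{\mathbf b}=T_{w_{\mathbf b}}$. $\mathcal H_{d,\mathbf b}=\mathcal H_{d,b_1}(\varepsilon\mathbf Q)\otimes\cdots\otimes\mathcal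 H_{d,b_p}(\varepsilon^p\mathbf Q)$, with $\mathrm{Tr}_{\mathbf b}:\mathcal H_{d,\mathbf b}\to R$ the $R$-linear map sending a basis element $\bigotimes_t(L_1^{a_{t,1}}\cdots L_{b_t}^{a_{t,b_t}}T_{x_t})$ ($0\le a_{t,j}<d$, $x_t\in\mathfrak S_{b_t}$) to $1$ if all $a_{t,j}=0$ and all $x_t=1$, and to $0$ otherwise. $\Theta_{\mathbf b}:\mathcal H_{d,\mathbf b}\to\mathcal H_{r,n}$ is the $R$-linear map sending this basis element to $\prod_{t=1}^p\prod_{j=1}^{b_t}L^{a_{t,j}}_{\mathbf b_1^{t-1}+j}\cdot T_{x'_1}\cdots T_{x'_p}$, where $x'_t$ is $x_t$ with each $s_i$ replaced by $s_{i+\mathbf b_1^{t-1}}$. *)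

theory Defs
  imports Main "HOL-Combinatorics.Permutations"
begin

definition stp :: "nat \<Rightarrow> nat \<Rightarrow> nat" where
  "stp i = (\<lambda>j. if j = i then Suc i else if j = Suc i then i else j)"

definition perm_of_word :: "nat list \<Rightarrow> nat \<Rightarrow> nat" where
  "perm_of_word ws = foldr (\<lambda>i f. stp i \<circ> f) ws id"

definition reduced_word :: "nat \<Rightarrow> (nat \<Rightarrow> nat) \<Rightarrow> nat list \<Rightarrow> bool" where
  "reduced_word m w ws \<longleftrightarrow> set ws \<subseteq> {1..<m} \<and> perm_of_word ws = w \<and>
     (\<forall>vs. set vs \<subseteq> {1..<m} \<and> perm_of_word vs = w \<longrightarrow> length ws \<le> length vs)"

definition Tw :: "(nat \<Rightarrow> 'a::monoid_mult) \<Rightarrow> nat \<Rightarrow> (nat \<Rightarrow> nat) \<Rightarrow> 'a" where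
  "Tw T m w = prod_list (map T (SOME ws. reduced_word m w ws))"

(* ---------- R-algebras: A is a ring with a central ring homomorphism iota : R -> A ---------- *)

definition rinv :: "'r::comm_ring_1 \<Rightarrow> 'r" where
  "rinv x = (THE y. x * y = 1)"

definition unit_el :: "'r::comm_ring_1 \<Rightarrow> bool" where
  "unit_el x \<longleftrightarrow> (\<exists>y. x * y = 1)"

definition is_basis :: "('r::comm_ring_1 \<Rightarrow> 'a::ring_1) \<Rightarrow> ('i \<Rightarrow> 'a) \<Rightarrow> 'i set \<Rightarrow> bool" where
  "is_basis \<iota> B I \<longleftrightarrow> finite I \<and>
     (\<forall>x. \<exists>!c. (\<forall>i. i \<notin> I \<longrightarrow> c i = 0) \<and> x = (\<Sum>i\<in>I. \<iota> (c i) * B i))"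

definition coords :: "('r::comm_ring_1 \<Rightarrow> 'a::ring_1) \<Rightarrow> ('i \<Rightarrow> 'a) \<Rightarrow> 'i set \<Rightarrow> 'a \<Rightarrow> 'i \<Rightarrow> 'r" where
  "coords \<iota> B I x = (THE c. (\<forall>i. i \<notin> I \<longrightarrow> c i = 0) \<and> x = (\<Sum>i\<in>I. \<iota> (c i) * B i))"

fun JM :: "('r::comm_ring_1 \<Rightarrow> 'a::ring_1) \<Rightarrow> 'r \<Rightarrow> (nat \<Rightarrow> 'a) \<Rightarrow> nat \<Rightarrow> 'a" where
  "JM \<iota> q T 0 = 0"
| "JM \<iota> q T (Suc 0) = T 0"
| "JM \<iota> q T (Suc (Suc k)) = \<iota> (rinv q) * T (Suc k) * JM \<iota> q T (Suc k) * T (Suc k)"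

definition AK_index :: "nat \<Rightarrow> nat \<Rightarrow> ((nat \<Rightarrow> nat) \<times> (nat \<Rightarrow> nat)) set" where
  "AK_index s m = {(a, w). (\<forall>j. a j < s) \<and> (\<forall>j. j \<notin> {1..m} \<longrightarrow> a j = 0) \<and> w permutes {1..m}}"

definition AK_basis :: "('r::comm_ring_1 \<Rightarrow> 'a::ring_1) \<Rightarrow> 'r \<Rightarrow> (nat \<Rightarrow> 'a) \<Rightarrow> nat
    \<Rightarrow> (nat \<Rightarrow> nat) \<times> (nat \<Rightarrow> nat) \<Rightarrow> 'a" where
  "AK_basis \<iota> q T m aw = prod_list (map (\<lambda>j. JM \<iota> q T j ^ (fst aw j)) [1..<m+1]) * Tw T m (snd aw)"

(* A (with structure map iota and elements T_0..T_{m-1}) is the Ariki-Koike algebra H_{s,m}(Qs)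
   with parameters q, Qs (s = length Qs): it is an R-algebra generated by T_0..T_{m-1} subject to
   the defining relations, and the standard elements form an R-basis.  By the universal property
   such an algebra is isomorphic to H_{s,m}(Qs). *)
definition AK_algebra :: "('r::comm_ring_1 \<Rightarrow> 'a::ring_1) \<Rightarrow> 'r \<Rightarrow> 'r list \<Rightarrow> nat \<Rightarrow> (nat \<Rightarrow> 'a) \<Rightarrow> bool" where
  "AK_algebra \<iota> q Qs m T \<longleftrightarrow>
     \<iota> 1 = 1 \<and> (\<forall>x y. \<iota> (x + y) = \<iota> x + \<iota> y) \<and> (\<forall>x y. \<iota> (x * y) = \<iota> x * \<iota> y) \<and>
     (\<forall>c x. \<iota> c * x = x * \<iota> c) \<and>
     prod_list (map (\<lambda>Q'. T 0 - \<iota> Q') Qs) = 0 \<and>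
     (\<forall>i. 1 \<le> i \<and> i < m \<longrightarrow> (T i - \<iota> q) * (T i + 1) = 0) \<and>
     (1 < m \<longrightarrow> T 0 * T 1 * T 0 * T 1 = T 1 * T 0 * T 1 * T 0) \<and>
     (\<forall>i. 1 \<le> i \<and> i + 1 < m \<longrightarrow> T i * T (i+1) * T i = T (i+1) * T i * T (i+1)) \<and>
     (\<forall>i j. i < m \<and> j < m \<and> i + 1 < j \<longrightarrow> T i * T j = T j * T i) \<and>
     is_basis \<iota> (AK_basis \<iota> q T m) (AK_index (length Qs) m)"

definition AK_Tr :: "('r::comm_ring_1 \<Rightarrow> 'a::ring_1) \<Rightarrow> 'r \<Rightarrow> (nat \<Rightarrow> 'a) \<Rightarrow> nat \<Rightarrow> nat \<Rightarrow> 'a \<Rightarrow> 'r" where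
  "AK_Tr \<iota> q T s m x = coords \<iota> (AK_basis \<iota> q T m) (AK_index s m) x (\<lambda>_. 0, id)"

definition AK_params :: "'r::comm_ring_1 \<Rightarrow> nat \<Rightarrow> nat \<Rightarrow> (nat \<Rightarrow> 'r) \<Rightarrow> 'r list" where
  "AK_params \<epsilon> p d Q = concat (map (\<lambda>s. map (\<lambda>i. \<epsilon> ^ s * Q i) [1..<d+1]) [1..<p+1])"

definition primitive_root :: "'r::comm_ring_1 \<Rightarrow> nat \<Rightarrow> bool" where
  "primitive_root \<epsilon> p \<longleftrightarrow> \<epsilon> ^ p = 1 \<and> (\<forall>k. 0 < k \<and> k < p \<longrightarrow> \<epsilon> ^ k \<noteq> 1)"

definition Ls :: "('r::comm_ring_1 \<Rightarrow> 'a::ring_1) \<Rightarrow> 'r \<Rightarrow> (nat \<Rightarrow> 'a) \<Rightarrow> 'r \<Rightarrow> nat \<Rightarrow> (nat \<Rightarrow> 'r)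
    \<Rightarrow> nat \<Rightarrow> nat \<Rightarrow> 'a" where
  "Ls \<iota> q T \<epsilon> d Q s k = prod_list (map (\<lambda>i. JM \<iota> q T k - \<iota> (\<epsilon> ^ s * Q i)) [1..<d+1])"

definition Iset :: "nat \<Rightarrow> nat \<Rightarrow> nat \<Rightarrow> nat list" where
  "Iset p i j = (if i \<le> j then [i..<j+1] else [1..<j+1] @ [i..<p+1])"

definition Lij :: "('r::comm_ring_1 \<Rightarrow> 'a::ring_1) \<Rightarrow> 'r \<Rightarrow> (nat \<Rightarrow> 'a) \<Rightarrow> 'r \<Rightarrow> nat \<Rightarrow> nat \<Rightarrow> (nat \<Rightarrow> 'r)
    \<Rightarrow> nat \<Rightarrow> nat \<Rightarrow> nat \<Rightarrow> nat \<Rightarrow> 'a" where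
  "Lij \<iota> q T \<epsilon> p d Q i j l m =
     prod_list (concat (map (\<lambda>k. map (\<lambda>s. Ls \<iota> q T \<epsilon> d Q s k) (Iset p i j)) [l..<m+1]))"

definition wword :: "nat \<Rightarrow> nat \<Rightarrow> nat \<Rightarrow> nat list" where
  "wword k a b = concat (replicate b (rev [k+1..<a+b+k]))"

definition bs :: "(nat \<Rightarrow> nat) \<Rightarrow> nat \<Rightarrow> nat \<Rightarrow> nat" where
  "bs b i j = (\<Sum>t\<in>{i..j}. b t)"

definition comp_pn :: "nat \<Rightarrow> nat \<Rightarrow> (nat \<Rightarrow> nat) \<Rightarrow> bool" where
  "comp_pn p n b \<longleftrightarrow> (\<Sum>t\<in>{1..p}. b t) = n"

definition vb :: "('r::comm_ring_1 \<Rightarrow> 'a::ring_1) \<Rightarrow> 'r \<Rightarrow> (nat \<Rightarrow> 'a) \<Rightarrow> 'r \<Rightarrow> nat \<Rightarrow> nat \<Rightarrow> (nat \<Rightarrow> 'r)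
    \<Rightarrow> nat \<Rightarrow> (nat \<Rightarrow> nat) \<Rightarrow> 'a" where
  "vb \<iota> q T \<epsilon> p d Q n b =
     prod_list (map (\<lambda>t. Lij \<iota> q T \<epsilon> p d Q 1 (t - 1) 1 (b t)
                         * Tw T n (perm_of_word (wword 0 (b t) (bs b 1 (t - 1))))) (rev [2..<p+1]))
   * prod_list (map (\<lambda>t. Lij \<iota> q T \<epsilon> p d Q t t 1 (bs b 1 (t - 1))) [2..<p+1])"

definition Tb :: "(nat \<Rightarrow> 'a::ring_1) \<Rightarrow> nat \<Rightarrow> nat \<Rightarrow> (nat \<Rightarrow> nat) \<Rightarrow> 'a" where
  "Tb T p n b = Tw T n (perm_of_word
      (concat (map (\<lambda>t. wword (bs b 1 (t - 1)) (b t) (bs b (t+1) p)) (rev [1..<p]))))"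

(* ---------- H_{d,b} (as a free R-module on its standard basis), Tr_b, Theta_b ---------- *)

(* index set of the basis of H_{d,b_1} (x) ... (x) H_{d,b_p}: pairs (a,x) with a t j = a_{t,j}, x t = x_t *)
definition Hb_index :: "nat \<Rightarrow> nat \<Rightarrow> (nat \<Rightarrow> nat) \<Rightarrow> ((nat \<Rightarrow> nat \<Rightarrow> nat) \<times> (nat \<Rightarrow> nat \<Rightarrow> nat)) set" where
  "Hb_index p d b = {(a, x).
      (\<forall>t j. a t j < d) \<and>
      (\<forall>t j. \<not> (1 \<le> t \<and> t \<le> p \<and> 1 \<le> j \<and> j \<le> b t) \<longrightarrow> a t j = 0) \<and>
      (\<forall>t. 1 \<le> t \<and> t \<le> p \<longrightarrow> x t permutes {1..b t}) \<and>
      (\<forall>t. \<not> (1 \<le> t \<and> t \<le> p) \<longrightarrow> x t = id)}"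

(* Tr_b of h = sum_i h_i e_i *)
definition Tr_b :: "(((nat \<Rightarrow> nat \<Rightarrow> nat) \<times> (nat \<Rightarrow> nat \<Rightarrow> nat)) \<Rightarrow> 'r::comm_ring_1) \<Rightarrow> 'r" where
  "Tr_b h = h (\<lambda>t j. 0, \<lambda>t. id)"

(* x_t with s_i replaced by s_{i+k} *)
definition shiftp :: "nat \<Rightarrow> nat \<Rightarrow> (nat \<Rightarrow> nat) \<Rightarrow> nat \<Rightarrow> nat" where
  "shiftp k m x = (\<lambda>i. if k < i \<and> i \<le> k + m then x (i - k) + k else i)"

definition Theta_basis :: "('r::comm_ring_1 \<Rightarrow> 'a::ring_1) \<Rightarrow> 'r \<Rightarrow> (nat \<Rightarrow> 'a) \<Rightarrow> nat \<Rightarrow> nat \<Rightarrow> (nat \<Rightarrow> nat)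
    \<Rightarrow> (nat \<Rightarrow> nat \<Rightarrow> nat) \<times> (nat \<Rightarrow> nat \<Rightarrow> nat) \<Rightarrow> 'a" where
  "Theta_basis \<iota> q T p n b ax =
     prod_list (concat (map (\<lambda>t. map (\<lambda>j. JM \<iota> q T (bs b 1 (t - 1) + j) ^ (fst ax t j)) [1..<b t + 1]) [1..<p+1]))
   * prod_list (map (\<lambda>t. Tw T n (shiftp (bs b 1 (t - 1)) (b t) (snd ax t))) [1..<p+1])"

definition Theta_b :: "('r::comm_ring_1 \<Rightarrow> 'a::ring_1) \<Rightarrow> 'r \<Rightarrow> (nat \<Rightarrow> 'a) \<Rightarrow> nat \<Rightarrow> nat \<Rightarrow> nat \<Rightarrow> (nat \<Rightarrow> nat)
    \<Rightarrow> (((nat \<Rightarrow> nat \<Rightarrow> nat) \<times> (nat \<Rightarrow> nat \<Rightarrow> nat)) \<Rightarrow> 'r) \<Rightarrow> 'a" where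
  "Theta_b \<iota> q T p d n b h = (\<Sum>ax\<in>Hb_index p d b. \<iota> (h ax) * Theta_basis \<iota> q T p n b ax)"

end

theory Submission
  imports Defs
begin

text \<open>
  Work modulo the span N of all basis elements X^c T_w with c nonzero. The trace vanishes on N, and
  N is stable under multiplication by every T_i (i > 0) on either side, since moving T_i past a
  monomial in the Jucys--Murphy elements X_k preserves the total degree and does not raise the
  maximal exponent.

  Write v_b = A_p T(w_p) ... A_2 T(w_2) B, where A_t is a polynomial in X_1, ..., X_(b_t) of degree
  d(t-1) in each variable and B has degree at most d(p-t) in the variables of block t. Moving A_t to
  the right through T(w_t) sends every nonconstant term to combinations of monomials that involve a
  variable of block t. These variables commute with everything that A_(t-1), w_(t-1), ... can
  produce, and together with B and a monomial of h the exponents stay below pd, so such terms lie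
  in N. Hence, modulo N, v_b X^a T_x is zero for a nonzero and a scalar times T(w_p ... w_2) T_x for
  a = 0. Lengths add in this product, and w_p ... w_2 is the inverse of w_b. As the trace of
  T_u T_v vanishes unless uv = 1, only x = 1 contributes.
\<close>

section \<open>Reduced words\<close>

text \<open>The obstacle is overflow of exponents. Only \<open>X 1\<close> has a defining relation
  of degree \<open>r\<close>, and using it can produce constant terms, so left multiplication by
  \<open>T 0\<close> need not preserve \<open>N\<close>. Two kinds of variables are therefore
  treated differently. Those of earlier blocks live in a subalgebra \<open>alg m\<close> generated
  by \<open>T 0\<close>, ..., \<open>T (m - 1)\<close>; there exponents may overflow freely, since
  rewriting into normal form involves the first \<open>m\<close> variables only. Those of the
  current block commute with \<open>alg m\<close> and must never reach exponent \<open>r\<close>. In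
  block s the budget per variable is d(p - s) from B, at most d - 1 from the monomial of h, and d(s
  - 1) from A_s; the total is at most pd - 1, which just fits below r = pd.

  A nonzero exponent alone is not enough: it has to sit in the current block, because an exponent in
  an earlier block can be lost in the rewriting. This is why the position of a positive exponent is
  followed along a reduced word.

  The scalar left over modulo \<open>N\<close> is never computed. It only has to be independent of
  h; for the identity basis element both sides are literally the same trace.\<close>

definition Inv :: "(nat \<Rightarrow> nat) \<Rightarrow> (nat \<times> nat) set" where
  "Inv w = {(i, j). i < j \<and> w j < w i}"

definition ninv :: "(nat \<Rightarrow> nat) \<Rightarrow> nat" where
  "ninv w = card (Inv w)"

lemma stp_stp [simp]: "stp i (stp i j) = j"
  by (auto simp: stp_def)

lemma stp_comp_stp [simp]: "stp i \<circ> stp i = id" "w \<circ> stp i \<circ> stp i = w"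
  by (auto simp: fun_eq_iff)

lemma stp_simps [simp]: "stp i i = Suc i" "stp i (Suc i) = i"
  "j \<noteq> i \<Longrightarrow> j \<noteq> Suc i \<Longrightarrow> stp i j = j"
  by (auto simp: stp_def)

lemma stp_permutes: "i \<in> {1..<n} \<Longrightarrow> stp i permutes {1..n}"
proof -
  assume "i \<in> {1..<n}"
  moreover have "stp i = transpose i (Suc i)"
    by (auto simp: fun_eq_iff stp_def transpose_def)
  ultimately show ?thesis by (simp add: permutes_swap_id)
qed

lemma perm_of_word_Nil [simp]: "perm_of_word [] = id"
  and perm_of_word_Cons [simp]: "perm_of_word (i # ws) = stp i \<circ> perm_of_word ws"
  by (simp_all add: perm_of_word_def)

lemma perm_of_word_append [simp]: "perm_of_word (us @ vs) = perm_of_word us \<circ> perm_of_word vs"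
  by (induction us) (auto simp: o_assoc)

lemma perm_of_word_permutes:
  "set ws \<subseteq> {1..<n} \<Longrightarrow> perm_of_word ws permutes {1..n}"
proof (induction ws)
  case Nil
  show ?case using permutes_id by (simp add: id_def)
next
  case (Cons i ws)
  then show ?case using permutes_compose[of _ "{1..n}" "stp i"] stp_permutes[of i n] by (simp add: comp_def)
qed

lemma finite_Inv:
  assumes "w permutes {1..n}"
  shows "finite (Inv w)"
proof (rule finite_subset)
  show "Inv w \<subseteq> {..n} \<times> {..n}"
  proof clarsimp
    fix i j assume "(i, j) \<in> Inv w"
    then have ij: "i < j" "w j < w i" by (auto simp: Inv_def)
    have "j \<le> n"
    proof (rule ccontr)
      assume "\<not> j \<le> n"
      then have "w j = j" using assms by (simp add: permutes_not_in)
      then have "w i \<notin> {1..n}" using ij \<open>\<not> j \<le> n\<close> by auto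
      then have "w i = i" using assms permutes_in_image permutes_not_in by metis
      then show False using ij \<open>w j = j\<close> by simp
    qed
    then show "i \<le> n \<and> j \<le> n" using ij by simp
  qed
qed simp

lemma stp_less: "a < b \<Longrightarrow> (a, b) \<noteq> (i, Suc i) \<Longrightarrow> stp i a < stp i b"
  by (auto simp: stp_def)

text \<open>\<open>stp i\<close> preserves the order of every pair except (\<open>i\<close>,
  \<open>Suc i\<close>), which at an ascent is no inversion of \<open>w\<close>. So the old
  inversions are merely relabelled and exactly one is added.\<close>

lemma Inv_stp:
  assumes "w i < w (Suc i)"
  shows "Inv (w \<circ> stp i) = insert (i, Suc i) (map_prod (stp i) (stp i) ` Inv w)" (is "?L = ?R")
    and "(i, Suc i) \<notin> map_prod (stp i) (stp i) ` Inv w"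
proof -
  show "(i, Suc i) \<notin> map_prod (stp i) (stp i) ` Inv w"
  proof
    assume "(i, Suc i) \<in> map_prod (stp i) (stp i) ` Inv w"
    then obtain a b where "a < b" "i = stp i a" "Suc i = stp i b" by (auto simp: Inv_def)
    then have "a = Suc i" "b = i" by (metis stp_stp stp_simps)+
    with \<open>a < b\<close> show False by simp
  qed
  show "?L = ?R"
  proof (intro equalityI subsetI)
    fix x assume x: "x \<in> ?L"
    obtain a b where ab: "x = (a, b)" "a < b" "w (stp i b) < w (stp i a)"
      using x by (auto simp: Inv_def)
    show "x \<in> ?R"
    proof (cases "x = (i, Suc i)")
      case False
      then have "(stp i a, stp i b) \<in> Inv w" using ab stp_less[of a b i] by (auto simp: Inv_def)
      then have "map_prod (stp i) (stp i) (stp i a, stp i b) \<in> map_prod (stp i) (stp i) ` Inv w"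
        by blast
      then show ?thesis using ab by simp
    qed simp
  next
    fix x assume "x \<in> ?R"
    then consider "x = (i, Suc i)" | a b where "x = (stp i a, stp i b)" "(a, b) \<in> Inv w" by auto
    then show "x \<in> ?L"
    proof cases
      case 1
      then show ?thesis using assms by (simp add: Inv_def)
    next
      case 2
      then have "(a, b) \<noteq> (i, Suc i)" using assms by (auto simp: Inv_def)
      then show ?thesis using 2 stp_less[of a b i] by (auto simp: Inv_def)
    qed
  qed
qed

lemma ninv_stp_asc:
  assumes "w permutes {1..n}" "w i < w (Suc i)"
  shows "ninv (w \<circ> stp i) = Suc (ninv w)"
proof -
  have "inj (map_prod (stp i) (stp i))" by (rule injI) (metis map_prod_simp prod.collapse stp_stp prod.inject)
  then show ?thesis
    unfolding ninv_def Inv_stp(1)[OF assms(2)]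
    using Inv_stp(2)[OF assms(2)] finite_Inv[OF assms(1)]
    by (simp add: card_image inj_on_subset)
qed

lemma ninv_stp_desc:
  assumes "w permutes {1..n}" "i \<in> {1..<n}" "w (Suc i) < w i"
  shows "ninv w = Suc (ninv (w \<circ> stp i))"
proof -
  have "w \<circ> stp i permutes {1..n}" using assms stp_permutes permutes_compose by blast
  from ninv_stp_asc[OF this, of i] show ?thesis using assms by simp
qed

lemma permutes_asc_desc:
  assumes "w permutes {1..n}"
  shows "w i < w (Suc i) \<or> w (Suc i) < w i"
  using permutes_inj[OF assms] by (metis injD n_not_Suc_n nat_neq_iff)

lemma permutes_comp_stp: "w permutes {1..n} \<Longrightarrow> i \<in> {1..<n} \<Longrightarrow> w \<circ> stp i permutes {1..n}"
  using stp_permutes permutes_compose by blast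

lemma ninv_stp_le:
  assumes "w permutes {1..n}" "i \<in> {1..<n}"
  shows "ninv (w \<circ> stp i) \<le> Suc (ninv w)"
  using permutes_asc_desc[OF assms(1), of i] ninv_stp_asc[OF assms(1), of i] ninv_stp_desc[OF assms]
  by auto

lemma ninv_id [simp]: "ninv id = 0"
proof -
  have "Inv id = {}" by (auto simp: Inv_def)
  then show ?thesis by (simp add: ninv_def)
qed

lemma ninv_perm_of_word_le: "set ws \<subseteq> {1..<n} \<Longrightarrow> ninv (perm_of_word ws) \<le> length ws"
proof (induction ws rule: rev_induct)
  case (snoc i ws)
  then show ?case using ninv_stp_le[OF perm_of_word_permutes, of ws n i] by (simp add: comp_def)
qed simp

lemma no_descent_id:
  assumes w: "w permutes {1..n}" and asc: "\<And>i. i \<in> {1..<n} \<Longrightarrow> w i < w (Suc i)"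
  shows "w = id"
proof -
  have "i \<le> n \<Longrightarrow> i \<le> w i" for i
  proof (induction i)
    case (Suc i)
    show ?case
    proof (cases "i = 0")
      case True
      then have "w (Suc i) \<in> {1..n}" using w Suc.prems by (subst permutes_in_image) auto
      then show ?thesis using True by simp
    next
      case False
      then show ?thesis using asc[of i] Suc by simp
    qed
  qed simp
  then show ?thesis using permutes_natset_ge[OF w] by simp
qed

text \<open>Bubble sort: as long as a descent exists, removing it lowers the inversion number by
  one; a permutation without descents is the identity.\<close>

lemma exists_reduced_word:
  assumes "w permutes {1..n}"
  shows "\<exists>ws. set ws \<subseteq> {1..<n} \<and> perm_of_word ws = w \<and> length ws = ninv w"
  using assms
proof (induction "ninv w" arbitrary: w rule: less_induct)
  case less
  show ?case
  proof (cases "\<exists>i\<in>{1..<n}. w (Suc i) < w i")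
    case True
    then obtain i where i: "i \<in> {1..<n}" "w (Suc i) < w i" by blast
    note d = ninv_stp_desc[OF less.prems i]
    then obtain ws where ws: "set ws \<subseteq> {1..<n}" "perm_of_word ws = w \<circ> stp i"
        "length ws = ninv (w \<circ> stp i)"
      using less.hyps[of "w \<circ> stp i"] permutes_comp_stp[OF less.prems i(1)] by auto
    have "set (ws @ [i]) \<subseteq> {1..<n}" "perm_of_word (ws @ [i]) = w" "length (ws @ [i]) = ninv w"
      using ws i d by auto
    then show ?thesis by blast
  next
    case False
    then have "w = id" using no_descent_id[OF less.prems] permutes_asc_desc[OF less.prems] by meson
    then show ?thesis by (intro exI[of _ "[]"]) simp
  qed
qed

text \<open>Replaces minimality over all words by a number that changes by exactly one with each
  letter.\<close>

lemma reduced_word_iff: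
  "reduced_word n w ws \<longleftrightarrow> set ws \<subseteq> {1..<n} \<and> perm_of_word ws = w \<and> length ws = ninv w"
proof
  assume r: "reduced_word n w ws"
  then have ws: "set ws \<subseteq> {1..<n}" "perm_of_word ws = w" by (auto simp: reduced_word_def)
  then obtain vs where "set vs \<subseteq> {1..<n}" "perm_of_word vs = w" "length vs = ninv w"
    using exists_reduced_word perm_of_word_permutes by metis
  then have "length ws \<le> ninv w" using r by (auto simp: reduced_word_def)
  then show "set ws \<subseteq> {1..<n} \<and> perm_of_word ws = w \<and> length ws = ninv w"
    using ws ninv_perm_of_word_le[of ws n] by simp
next
  assume "set ws \<subseteq> {1..<n} \<and> perm_of_word ws = w \<and> length ws = ninv w"
  then show "reduced_word n w ws"
    unfolding reduced_word_def using ninv_perm_of_word_le by metis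
qed

lemma reduced_word_ex: "w permutes {1..n} \<Longrightarrow> \<exists>ws. reduced_word n w ws"
  using exists_reduced_word by (simp add: reduced_word_iff)

lemma reduced_word_permutes: "reduced_word n w ws \<Longrightarrow> w permutes {1..n}"
  using perm_of_word_permutes by (auto simp: reduced_word_iff)

text \<open>Dropping the last letter must lower the inversion number, which happens only at a
  descent. This drives the inductions that peel words from the right.\<close>

lemma reduced_word_snoc_iff:
  "reduced_word n w (ws @ [i]) \<longleftrightarrow>
     i \<in> {1..<n} \<and> w (Suc i) < w i \<and> reduced_word n (w \<circ> stp i) ws"
proof
  assume r: "reduced_word n w (ws @ [i])"
  then have w: "w permutes {1..n}" by (rule reduced_word_permutes)
  have e: "perm_of_word ws = w \<circ> stp i" and i: "i \<in> {1..<n}" and ws: "set ws \<subseteq> {1..<n}"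
    using r by (auto simp: reduced_word_iff)
  have "ninv (w \<circ> stp i) < ninv w"
    using ninv_perm_of_word_le[OF ws] r e by (auto simp: reduced_word_iff)
  then have d: "w (Suc i) < w i"
    using permutes_asc_desc[OF w, of i] ninv_stp_asc[OF w, of i] by force
  then show "i \<in> {1..<n} \<and> w (Suc i) < w i \<and> reduced_word n (w \<circ> stp i) ws"
    using i ws e r ninv_stp_desc[OF w i d] by (auto simp: reduced_word_iff)
next
  assume a: "i \<in> {1..<n} \<and> w (Suc i) < w i \<and> reduced_word n (w \<circ> stp i) ws"
  then have "w \<circ> stp i permutes {1..n}" using reduced_word_permutes by blast
  then have "w \<circ> stp i \<circ> stp i permutes {1..n}" using permutes_comp_stp a by blast
  then have w: "w permutes {1..n}" by simp
  show "reduced_word n w (ws @ [i])"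
    using a ninv_stp_desc[OF w, of i] by (auto simp: reduced_word_iff)
qed

lemma inv_perm: "w permutes S \<Longrightarrow> v \<circ> w = id \<Longrightarrow> v = inv w"
  by (metis comp_id comp_assoc id_comp permutes_inv_o(1))

lemma ninv_inv:
  assumes "w permutes {1..n}"
  shows "ninv (inv w) = ninv w"
proof -
  have bij: "bij w" using assms by (rule permutes_bij)
  have "bij_betw (\<lambda>(i, j). (w j, w i)) (Inv w) (Inv (inv w))"
    by (rule bij_betw_byWitness[where f' = "\<lambda>(i, j). (inv w j, inv w i)"])
      (use bij in \<open>auto simp: Inv_def bij_is_inj bij_is_surj surj_f_inv_f inv_f_f\<close>)
  then show ?thesis using bij_betw_same_card by (fastforce simp: ninv_def)
qed

text \<open>Left-hand counterpart, obtained through the inverse: composing with \<open>stp i\<close>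
  on the left of \<open>w\<close> is composing on the right of \<open>inv w\<close>, and both have
  the same inversion number. The ascent in the last conclusion settles the descent case of
  \<open>Tr_Tw_Tw\<close>.\<close>

lemma reduced_word_Cons:
  assumes "reduced_word n w (i # ws)"
  shows "i \<in> {1..<n}" "reduced_word n (stp i \<circ> w) ws" "inv (stp i \<circ> w) i < inv (stp i \<circ> w) (Suc i)"
proof -
  show i: "i \<in> {1..<n}" using assms by (simp add: reduced_word_iff)
  have w: "w permutes {1..n}" using assms by (rule reduced_word_permutes)
  have wi: "inv w permutes {1..n}" using w by (rule permutes_inv)
  have ws: "set ws \<subseteq> {1..<n}" and e: "w = stp i \<circ> perm_of_word ws" using assms by (auto simp: reduced_word_iff)
  then have e': "perm_of_word ws = stp i \<circ> w" by (simp add: o_assoc)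
  have p: "stp i \<circ> w permutes {1..n}" using e' perm_of_word_permutes[OF ws] by simp
  have "inv (stp i \<circ> w) = inv w \<circ> stp i"
    by (rule inv_perm[OF p, symmetric]) (simp add: fun_eq_iff permutes_inverses(2)[OF w])
  note iv = this
  have l: "ninv (stp i \<circ> w) = ninv (inv w \<circ> stp i)" using ninv_inv[OF p] iv by simp
  have k: "ninv (inv w) = ninv w" "length ws < ninv w" using ninv_inv[OF w] assms by (auto simp: reduced_word_iff)
  have le: "ninv (stp i \<circ> w) \<le> length ws" using ninv_perm_of_word_le[OF ws] e' by simp
  have d: "inv w (Suc i) < inv w i"
    using permutes_asc_desc[OF wi, of i] ninv_stp_asc[OF wi, of i] l k le by force
  then show "inv (stp i \<circ> w) i < inv (stp i \<circ> w) (Suc i)" by (simp add: iv)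
  show "reduced_word n (stp i \<circ> w) ws"
    using ws e' ninv_stp_desc[OF wi i d] l k assms by (auto simp: reduced_word_iff)
qed

section \<open>Matsumoto's theorem and length-additive products\<close>

locale braid =
  fixes T :: "nat \<Rightarrow> 'a::monoid_mult" and n :: nat
  assumes braid3: "\<And>i. 1 \<le> i \<Longrightarrow> Suc i < n \<Longrightarrow> T i * T (Suc i) * T i = T (Suc i) * T i * T (Suc i)"
    and braid2: "\<And>i j. i < n \<Longrightarrow> j < n \<Longrightarrow> Suc i < j \<Longrightarrow> T i * T j = T j * T i"
begin

abbreviation "Tp ws \<equiv> prod_list (map T ws)"

text \<open>\<open>u\<close> is \<open>w\<close> with the longest element of the subgroup generated
  by \<open>stp i\<close> and \<open>stp j\<close> stripped off on the right. By the induction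
  hypothesis both words may be replaced by words starting with a reduced word of \<open>u\<close>,
  and these differ by a single braid or commutation relation.\<close>

lemma matsumoto_step:
  assumes IH: "\<And>u us vs. length us < l \<Longrightarrow> reduced_word n u us \<Longrightarrow> reduced_word n u vs \<Longrightarrow> Tp us = Tp vs"
    and us: "reduced_word n w (us @ [i])" and vs: "reduced_word n w (vs @ [j])"
    and l: "length us < l" and ij: "i < j"
  shows "Tp us * T i = Tp vs * T j"
proof -
  have l': "length vs < l" using us vs l by (simp add: reduced_word_iff)
  note ri = us[unfolded reduced_word_snoc_iff] and rj = vs[unfolded reduced_word_snoc_iff]
  have w: "w permutes {1..n}" using us by (rule reduced_word_permutes)
  show ?thesis
  proof (cases "j = Suc i")
    case True
    define u where "u = w \<circ> stp i \<circ> stp j \<circ> stp i"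
    have u2: "u = w \<circ> stp j \<circ> stp i \<circ> stp j"
      unfolding u_def True by (auto simp: fun_eq_iff stp_def)
    have "u permutes {1..n}" unfolding u_def using permutes_comp_stp w ri rj by blast
    then obtain ws where ws: "reduced_word n u ws" using reduced_word_ex by blast
    have d: "w (Suc i) < w i" "w (Suc (Suc i)) < w (Suc i)" using ri rj True by auto
    have "reduced_word n (w \<circ> stp i) ((ws @ [i]) @ [j])"
      unfolding reduced_word_snoc_iff using ri rj ws d True by (auto simp: u_def stp_def)
    with IH[OF l] ri have e1: "Tp us = Tp ws * (T i * T j)" by (fastforce simp: mult.assoc)
    have "reduced_word n (w \<circ> stp j) ((ws @ [j]) @ [i])"
      unfolding reduced_word_snoc_iff using ri rj ws d True by (auto simp: u2 stp_def)
    with IH[OF l'] rj have e2: "Tp vs = Tp ws * (T j * T i)" by (fastforce simp: mult.assoc)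
    show ?thesis using e1 e2 braid3[of i] ri rj True by (simp add: mult.assoc)
  next
    case False
    define u where "u = w \<circ> stp i \<circ> stp j"
    have u2: "u = w \<circ> stp j \<circ> stp i"
      unfolding u_def using False ij by (auto simp: fun_eq_iff stp_def)
    have "u permutes {1..n}" unfolding u_def using permutes_comp_stp w ri rj by blast
    then obtain ws where ws: "reduced_word n u ws" using reduced_word_ex by blast
    have "reduced_word n (w \<circ> stp i) (ws @ [j])"
      unfolding reduced_word_snoc_iff using ri rj ws False ij by (auto simp: u_def stp_def)
    with IH[OF l] ri have e1: "Tp us = Tp ws * T j" by (fastforce simp: mult.assoc)
    have "reduced_word n (w \<circ> stp j) (ws @ [i])"
      unfolding reduced_word_snoc_iff using ri rj ws False ij by (auto simp: u2 stp_def)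
    with IH[OF l'] rj have e2: "Tp vs = Tp ws * T i" by (fastforce simp: mult.assoc)
    show ?thesis using e1 e2 braid2[of i j] ri rj False ij by (simp add: mult.assoc)
  qed
qed

lemma matsumoto:
  "reduced_word n w us \<Longrightarrow> reduced_word n w vs \<Longrightarrow> Tp us = Tp vs"
proof (induction "length us" arbitrary: w us vs rule: less_induct)
  case less
  have len: "length us = length vs" using less.prems by (simp add: reduced_word_iff)
  show ?case
  proof (cases us rule: rev_cases)
    case Nil
    then show ?thesis using len by simp
  next
    case (snoc us' i)
    then obtain vs' j where vs: "vs = vs' @ [j]" using len by (cases vs rule: rev_cases) auto
    have IH: "\<And>u xs ys. length xs < length us \<Longrightarrow> reduced_word n u xs \<Longrightarrow> reduced_word n u ys \<Longrightarrow> Tp xs = Tp ys"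
      using less.hyps by blast
    have r: "reduced_word n w (us' @ [i])" "reduced_word n w (vs' @ [j])"
      using less.prems snoc vs by auto
    have l: "length us' < length us" "length vs' < length us" using snoc vs len by auto
    consider "i = j" | "i < j" | "j < i" by linarith
    then have "Tp us' * T i = Tp vs' * T j"
    proof cases
      case 1
      then have "Tp us' = Tp vs'" using IH[OF l(1)] r[unfolded reduced_word_snoc_iff] by blast
      with 1 show ?thesis by simp
    next
      case 2
      show ?thesis by (rule matsumoto_step[OF IH r l(1) 2])
    next
      case 3
      show ?thesis by (rule matsumoto_step[OF IH r(2) r(1) l(2) 3, symmetric])
    qed
    then show ?thesis by (simp add: snoc vs)
  qed
qed

text \<open>Makes the arbitrary choice in \<open>Tw\<close> harmless: all reduced words of a
  permutation give the same product.\<close>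

lemma Tw_eq: "reduced_word n w ws \<Longrightarrow> Tw T n w = Tp ws"
  unfolding Tw_def using matsumoto someI by metis

lemma Tw_id [simp]: "Tw T n id = 1"
  using Tw_eq[of id "[]"] by (simp add: reduced_word_iff)

lemma Tw_asc:
  assumes "w permutes {1..n}" "i \<in> {1..<n}" "w i < w (Suc i)"
  shows "Tw T n w * T i = Tw T n (w \<circ> stp i)"
proof -
  obtain ws where "reduced_word n w ws" using reduced_word_ex assms(1) by blast
  moreover from this have "reduced_word n (w \<circ> stp i) (ws @ [i])"
    using assms by (simp add: reduced_word_snoc_iff)
  ultimately show ?thesis using Tw_eq by fastforce
qed

text \<open>The last hypothesis says that \<open>u\<close> undoes no inversion of \<open>v\<close>.
  It is the practical form of additivity of lengths, and it passes from \<open>v\<close> to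
  \<open>v \<circ> stp i\<close> when the last letter is peeled off.\<close>

lemma Tw_comp:
  assumes "u permutes {1..n}" "v permutes {1..n}"
    and "\<And>i j. i < j \<Longrightarrow> v j < v i \<Longrightarrow> u (v j) < u (v i)"
  shows "Tw T n u * Tw T n v = Tw T n (u \<circ> v)"
proof -
  obtain ws where "reduced_word n v ws" using reduced_word_ex assms(2) by blast
  then show ?thesis using assms(3)
  proof (induction ws arbitrary: v rule: rev_induct)
    case Nil
    then have "v = id" by (simp add: reduced_word_iff)
    then show ?case by (simp del: id_apply)
  next
    case (snoc i ws)
    let ?v = "v \<circ> stp i"
    have i: "i \<in> {1..<n}" "v (Suc i) < v i" and r: "reduced_word n ?v ws"
      using snoc.prems(1) by (auto simp: reduced_word_snoc_iff)
    have p: "?v permutes {1..n}" using r by (rule reduced_word_permutes)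
    have IH: "Tw T n u * Tw T n ?v = Tw T n (u \<circ> ?v)"
    proof (rule snoc.IH[OF r])
      fix a b assume "a < b" "?v b < ?v a"
      moreover then have "(a, b) \<noteq> (i, Suc i)" using i by auto
      ultimately show "u (?v b) < u (?v a)" using snoc.prems(2)[of "stp i a" "stp i b"] stp_less by auto
    qed
    have "Tw T n v = Tw T n ?v * T i" using Tw_asc[OF p i(1)] i(2) by simp
    moreover have "Tw T n (u \<circ> ?v) * T i = Tw T n (u \<circ> ?v \<circ> stp i)"
      using Tw_asc[of "u \<circ> ?v" i] permutes_compose[OF p assms(1)] i snoc.prems(2)[of i "Suc i"] by simp
    ultimately show ?case using IH by (simp add: mult.assoc[symmetric] comp_def)
  qed
qed

end

section \<open>Monomials in the Jucys--Murphy elements\<close>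

text \<open>The module structure is given only through \<open>\<iota>\<close>, so spans are
  generated inductively and closure properties become inductions over membership.\<close>

inductive_set lin_span :: "('r \<Rightarrow> 'a::ring_1) \<Rightarrow> 'a set \<Rightarrow> 'a set" for \<iota> S where
  zero: "0 \<in> lin_span \<iota> S"
| base: "x \<in> S \<Longrightarrow> x \<in> lin_span \<iota> S"
| add: "x \<in> lin_span \<iota> S \<Longrightarrow> y \<in> lin_span \<iota> S \<Longrightarrow> x + y \<in> lin_span \<iota> S"
| scale: "x \<in> lin_span \<iota> S \<Longrightarrow> \<iota> c * x \<in> lin_span \<iota> S"

lemma lin_span_sum: "(\<And>i. i \<in> I \<Longrightarrow> f i \<in> lin_span \<iota> S) \<Longrightarrow> sum f I \<in> lin_span \<iota> S"
  by (induction I rule: infinite_finite_induct) (auto intro: lin_span.intros)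

lemma lin_span_subset:
  assumes "x \<in> lin_span \<iota> S" "\<And>y. y \<in> S \<Longrightarrow> y \<in> lin_span \<iota> U"
  shows "x \<in> lin_span \<iota> U"
  using assms by (induction rule: lin_span.induct) (auto intro: lin_span.intros)

section \<open>Bernstein-type commutation relations in two variables\<close>

context
  fixes x y t k :: "'a::ring_1"
  assumes tx: "t * x = y * t - k * y" and ty: "t * y = x * t + k * y"
    and xy: "x * y = y * x" and kx: "k * x = x * k" and ky: "k * y = y * k"
begin

text \<open>Meant for \<open>t\<close> = \<open>T i\<close>, \<open>x\<close> = \<open>X i\<close>,
  \<open>y\<close> = \<open>X (Suc i)\<close> and \<open>k\<close> = \<open>\<iota> (q - 1)\<close>.
  The sum is \<open>y\<close> times the divided difference (y^e - x^e) / (y - x), written without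
  division; the point used later is that each of its terms contains \<open>y\<close>.\<close>

lemma demazure_power_left: "t * x ^ e = y ^ e * t - k * (\<Sum>g<e. x ^ g * y ^ (e - g))"
proof (induction e)
  case (Suc e)
  have p: "y * x ^ g = x ^ g * y" for g using power_commuting_commutes[OF xy] by simp
  have "t * x ^ Suc e = (t * x ^ e) * x" by (simp add: power_Suc2 mult.assoc del: power_Suc)
  also have "\<dots> = y ^ e * (y * t - k * y) - k * ((\<Sum>g<e. x ^ g * y ^ (e - g)) * x)"
    unfolding Suc by (simp add: left_diff_distrib mult.assoc tx)
  also have "(\<Sum>g<e. x ^ g * y ^ (e - g)) * x = (\<Sum>g<e. x ^ Suc g * y ^ (e - g))"
    unfolding sum_distrib_right
    by (rule sum.cong) (auto simp: mult.assoc power_Suc2 power_commuting_commutes[OF xy[symmetric]] simp del: power_Suc)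
  also have "y ^ e * (y * t - k * y) = y ^ Suc e * t - k * y ^ Suc e"
    using power_commuting_commutes[OF ky[symmetric]]
    by (simp add: right_diff_distrib power_Suc2 mult.assoc[symmetric] del: power_Suc)
  finally show ?case by (simp add: sum.lessThan_Suc_shift distrib_left del: sum.lessThan_Suc power_Suc)
qed simp

lemma demazure_power_right: "t * y ^ e = x ^ e * t + k * (\<Sum>g<e. x ^ g * y ^ (e - g))"
proof (induction e)
  case (Suc e)
  have "t * y ^ Suc e = (t * y ^ e) * y" by (simp add: power_Suc2 mult.assoc del: power_Suc)
  also have "\<dots> = x ^ e * (x * t + k * y) + k * ((\<Sum>g<e. x ^ g * y ^ (e - g)) * y)"
    unfolding Suc by (simp add: distrib_right mult.assoc ty)
  also have "(\<Sum>g<e. x ^ g * y ^ (e - g)) * y = (\<Sum>g<e. x ^ g * y ^ (Suc e - g))"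
    unfolding sum_distrib_right
    by (rule sum.cong) (auto simp: mult.assoc power_Suc2 Suc_diff_le simp del: power_Suc)
  also have "x ^ e * (x * t + k * y) = x ^ Suc e * t + k * (x ^ e * y)"
    using power_commuting_commutes[OF kx[symmetric], of e]
    by (simp add: distrib_left power_Suc2 mult.assoc[symmetric] del: power_Suc)
  finally show ?case by (simp add: distrib_left algebra_simps)
qed simp

text \<open>The corrections from passing \<open>x\<close> and from passing \<open>y\<close> have
  opposite signs and cancel.\<close>

lemma demazure_sym: "t * (x * y) = (x * y) * t"
proof -
  have "t * (x * y) = (t * x) * y" by (simp add: mult.assoc)
  also have "\<dots> = y * (t * y) - y * (k * y)"
    using ky by (simp add: tx left_diff_distrib mult.assoc)
  also have "\<dots> = x * y * t" by (simp add: ty distrib_left mult.assoc[symmetric] xy)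
  finally show ?thesis .
qed

lemma demazure_sym_power: "t * (x ^ a * y ^ a) = x ^ a * y ^ a * t"
proof -
  have "x ^ a * y ^ a = (x * y) ^ a"
    by (induction a) (simp_all add: mult.assoc power_commuting_commutes[OF xy] xy power_Suc2 del: power_Suc, metis (no_types) mult.assoc power_commuting_commutes xy)
  then show ?thesis using power_commuting_commutes[OF demazure_sym[symmetric]] by simp
qed

lemma power_mult_split: "x ^ a * y ^ a * (x ^ g * y ^ h) = x ^ (g + a) * y ^ (h + a)"
proof -
  have "y ^ a * x ^ g = x ^ g * y ^ a"
    using power_commuting_commutes[OF power_commuting_commutes[OF xy, symmetric], of a g] by simp
  then have "x ^ a * y ^ a * (x ^ g * y ^ h) = x ^ a * (x ^ g * y ^ a) * y ^ h"
    by (simp add: mult.assoc[symmetric]) (simp add: mult.assoc)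
  then show ?thesis by (simp add: power_add mult.assoc) (simp add: mult.assoc[symmetric] power_add[symmetric] add.commute)
qed

lemma kxy: "k * (x ^ a * y ^ b) = x ^ a * y ^ b * k"
  using power_commuting_commutes[OF kx[symmetric], of a] power_commuting_commutes[OF ky[symmetric], of b]
  by (metis mult.assoc)

text \<open>The common power of \<open>x\<close> and \<open>y\<close> commutes with
  \<open>t\<close>, so only the surplus power of \<open>y\<close> creates corrections. Hence in
  every term the exponents still add up to \<open>a + b\<close>, neither exceeds the larger of the
  two, and \<open>y\<close> occurs in each correction.\<close>

lemma demazure_le:
  assumes "a \<le> b"
  shows "t * (x ^ a * y ^ b) = x ^ b * y ^ a * t + k * (\<Sum>g<b - a. x ^ (g + a) * y ^ (b - g))"
proof -
  have "x ^ a * y ^ b = x ^ a * y ^ a * (x ^ 0 * y ^ (b - a))"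
    unfolding power_mult_split using assms by simp
  then have "t * (x ^ a * y ^ b) = (t * (x ^ a * y ^ a)) * y ^ (b - a)"
    by (simp add: mult.assoc)
  also have "\<dots> = x ^ a * y ^ a * (t * y ^ (b - a))"
    by (simp add: demazure_sym_power mult.assoc)
  also have "\<dots> = x ^ a * y ^ a * (x ^ (b - a) * y ^ 0) * t
      + x ^ a * y ^ a * k * (\<Sum>g<b - a. x ^ g * y ^ (b - a - g))"
    unfolding demazure_power_right by (simp add: distrib_left mult.assoc)
  also have "x ^ a * y ^ a * k * (\<Sum>g<b - a. x ^ g * y ^ (b - a - g))
      = k * (\<Sum>g<b - a. x ^ a * y ^ a * (x ^ g * y ^ (b - a - g)))"
    unfolding kxy[symmetric] by (simp add: sum_distrib_left mult.assoc)
  also have "(\<Sum>g<b - a. x ^ a * y ^ a * (x ^ g * y ^ (b - a - g)))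
      = (\<Sum>g<b - a. x ^ (g + a) * y ^ (b - g))"
    unfolding power_mult_split by (rule sum.cong) auto
  finally show ?thesis unfolding power_mult_split using assms by simp
qed

lemma demazure_ge:
  assumes "b \<le> a"
  shows "t * (x ^ a * y ^ b) = x ^ b * y ^ a * t - k * (\<Sum>g<a - b. x ^ (g + b) * y ^ (a - g))"
proof -
  have "x ^ a * y ^ b = x ^ b * y ^ b * (x ^ (a - b) * y ^ 0)"
    unfolding power_mult_split using assms by simp
  then have "t * (x ^ a * y ^ b) = (t * (x ^ b * y ^ b)) * x ^ (a - b)"
    by (simp add: mult.assoc)
  also have "\<dots> = x ^ b * y ^ b * (t * x ^ (a - b))"
    by (simp add: demazure_sym_power mult.assoc)
  also have "\<dots> = x ^ b * y ^ b * (x ^ 0 * y ^ (a - b)) * t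
      - x ^ b * y ^ b * k * (\<Sum>g<a - b. x ^ g * y ^ (a - b - g))"
    unfolding demazure_power_left by (simp add: right_diff_distrib mult.assoc)
  also have "x ^ b * y ^ b * k * (\<Sum>g<a - b. x ^ g * y ^ (a - b - g))
      = k * (\<Sum>g<a - b. x ^ b * y ^ b * (x ^ g * y ^ (a - b - g)))"
    unfolding kxy[symmetric] by (simp add: sum_distrib_left mult.assoc)
  also have "(\<Sum>g<a - b. x ^ b * y ^ b * (x ^ g * y ^ (a - b - g)))
      = (\<Sum>g<a - b. x ^ (g + b) * y ^ (a - g))"
    unfolding power_mult_split by (rule sum.cong) auto
  finally show ?thesis unfolding power_mult_split using assms by simp
qed

end

locale ariki_koike =
  fixes \<iota> :: "'r::comm_ring_1 \<Rightarrow> 'a::ring_1" and q :: 'r and Qs :: "'r list"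
    and n :: nat and T :: "nat \<Rightarrow> 'a"
  assumes AK: "AK_algebra \<iota> q Qs n T" and q_unit: "unit_el q" and n1: "1 < n" and Qs: "Qs \<noteq> []"
begin

lemma iota_simps [simp]:
  "\<iota> 1 = 1" "\<iota> 0 = 0" "\<iota> (x + y) = \<iota> x + \<iota> y" "\<iota> (x * y) = \<iota> x * \<iota> y" "\<iota> (- x) = - \<iota> x"
  "\<iota> (x - y) = \<iota> x - \<iota> y"
proof -
  show add: "\<iota> (x + y) = \<iota> x + \<iota> y" for x y
    using AK unfolding AK_algebra_def by blast
  show "\<iota> 1 = 1" "\<iota> (x * y) = \<iota> x * \<iota> y" using AK unfolding AK_algebra_def by blast+
  show z: "\<iota> 0 = 0" using add[of 0 0] by simp
  show m: "\<iota> (- x) = - \<iota> x" for x using add[of x "- x"] z by (simp add: eq_neg_iff_add_eq_0 add.commute)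
  show "\<iota> (x - y) = \<iota> x - \<iota> y" using add[of x "- y"] m by simp
qed

lemma iota_comm: "\<iota> c * x = x * \<iota> c"
  using AK unfolding AK_algebra_def by blast

lemma iota_left_comm: "x * (\<iota> c * y) = \<iota> c * (x * y)"
  using iota_comm by (metis mult.assoc)

sublocale braid T n
proof
  fix i j
  show "T i * T (Suc i) * T i = T (Suc i) * T i * T (Suc i)" if "1 \<le> i" "Suc i < n"
    using AK that unfolding AK_algebra_def Suc_eq_plus1 by blast
  show "T i * T j = T j * T i" if "i < n" "j < n" "Suc i < j"
    using AK that unfolding AK_algebra_def Suc_eq_plus1 by blast
qed

abbreviation "sp \<equiv> lin_span \<iota>"

lemma sp_minus: "x \<in> sp S \<Longrightarrow> - x \<in> sp S"
  using lin_span.scale[of x \<iota> S "-1"] by simp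

lemma sp_diff: "x \<in> sp S \<Longrightarrow> y \<in> sp S \<Longrightarrow> x - y \<in> sp S"
  using lin_span.add[OF _ sp_minus] by fastforce

lemma sp_mult:
  assumes "x \<in> sp S" "y \<in> sp S'" "\<And>u v. u \<in> S \<Longrightarrow> v \<in> S' \<Longrightarrow> u * v \<in> sp U"
  shows "x * y \<in> sp U"
  using assms(1)
proof (induction rule: lin_span.induct)
  case (base x)
  show ?case using assms(2) base
    by (induction rule: lin_span.induct)
      (auto intro: lin_span.intros assms(3) simp: distrib_left iota_left_comm)
qed (auto intro: lin_span.intros simp: distrib_right mult.assoc)

lemma sp_mult_left: "y \<in> sp S \<Longrightarrow> (\<And>v. v \<in> S \<Longrightarrow> x * v \<in> sp U) \<Longrightarrow> x * y \<in> sp U"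
  using sp_mult[of x "{x}" y S U] by (auto intro: lin_span.base)

lemma sp_mult_right: "y \<in> sp S \<Longrightarrow> (\<And>v. v \<in> S \<Longrightarrow> v * x \<in> sp U) \<Longrightarrow> y * x \<in> sp U"
  using sp_mult[of y S x "{x}"] by (auto intro: lin_span.base)

text \<open>\<open>rinv\<close> is a definite description, so uniqueness of the inverse has to be
  shown as well.\<close>

lemma iota_rinv_q: "\<iota> (rinv q) * \<iota> q = 1"
proof -
  obtain y where y: "q * y = 1" using q_unit by (auto simp: unit_el_def)
  have "z = y" if "q * z = 1" for z
  proof -
    have "z = (q * y) * z" by (simp add: y)
    also have "\<dots> = (q * z) * y" by (simp only: ac_simps)
    finally show ?thesis by (simp add: that)
  qed
  with y have "q * rinv q = 1" unfolding rinv_def by (rule theI)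
  then have "\<iota> (rinv q * q) = \<iota> 1" by (simp only: mult.commute)
  then show ?thesis by simp
qed

lemma T_sq: "i \<in> {1..<n} \<Longrightarrow> T i * T i = \<iota> (q - 1) * T i + \<iota> q"
proof -
  assume "i \<in> {1..<n}"
  then have "(T i - \<iota> q) * (T i + 1) = 0"
    using AK unfolding AK_algebra_def by (metis atLeastLessThan_iff)
  moreover have "T i * T i - (\<iota> (q - 1) * T i + \<iota> q) = (T i - \<iota> q) * (T i + 1)"
    by (simp add: algebra_simps)
  ultimately show ?thesis by simp
qed

section \<open>Jucys--Murphy elements and the subalgebras of smaller rank\<close>

abbreviation "X \<equiv> JM \<iota> q T"

lemma X_Suc: "1 \<le> k \<Longrightarrow> X (Suc k) = \<iota> (rinv q) * (T k * X k * T k)"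
  by (cases k) (auto simp: mult.assoc)

lemma X_comm_T_gt: "k < j \<Longrightarrow> j < n \<Longrightarrow> X k * T j = T j * X k"
proof (induction k)
  case (Suc k)
  show ?case
  proof (cases "k = 0")
    case True
    then show ?thesis using Suc braid2[of 0 j] by simp
  next
    case False
    then have "T k * T j = T j * T k" "X k * T j = T j * X k" using Suc braid2[of k j] by auto
    then have "T k * X k * T k * T j = T j * (T k * X k * T k)" by (metis mult.assoc)
    then show ?thesis using False by (simp add: X_Suc mult.assoc iota_left_comm)
  qed
qed simp

text \<open>The critical case is \<open>Suc j = k\<close>. For \<open>j = 0\<close> it is the
  four-term relation between \<open>T 0\<close> and \<open>T 1\<close>. Otherwise \<open>X k\<close>
  is expanded once more and the braid relation is used twice: \<open>T j\<close> turns into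
  \<open>T k\<close>, crosses \<open>X j\<close> in that form, and turns back.\<close>

lemma X_comm_T_less: "Suc j < k \<Longrightarrow> k \<le> n \<Longrightarrow> X k * T j = T j * X k"
proof (induction k)
  case (Suc k)
  then have k: "1 \<le> k" "k < n" "j < k" by auto
  have "T k * X k * T k * T j = T j * (T k * X k * T k)"
  proof (cases "Suc j = k")
    case False
    then have "T k * T j = T j * T k" "X k * T j = T j * X k" using Suc k braid2[of j k] by auto
    then show ?thesis by (metis mult.assoc)
  next
    case True
    show ?thesis
    proof (cases "j = 0")
      case True
      have "T 0 * T 1 * T 0 * T 1 = T 1 * T 0 * T 1 * T 0"
        using AK n1 unfolding AK_algebra_def by blast
      then show ?thesis using True \<open>Suc j = k\<close> by (auto simp: mult.assoc)
    next
      case False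
      then have xj: "X k = \<iota> (rinv q) * (T j * X j * T j)" using X_Suc True by auto
      have c: "X j * T k = T k * X j" using X_comm_T_gt k by simp
      have b: "T j * T k * T j = T k * T j * T k" using braid3[of j] True False k by simp
      have "T k * (T j * X j * T j) * T k * T j = T k * T j * X j * (T j * T k * T j)" by (simp add: mult.assoc)
      also have "\<dots> = T k * T j * (X j * T k) * T j * T k" unfolding b by (simp add: mult.assoc)
      also have "\<dots> = (T k * T j * T k) * X j * T j * T k" unfolding c by (simp add: mult.assoc)
      also have "\<dots> = T j * (T k * (T j * X j * T j) * T k)" unfolding b[symmetric] by (simp add: mult.assoc)
      finally show ?thesis unfolding xj by (simp add: mult.assoc iota_left_comm)
    qed
  qed
  then show ?case using k by (simp add: X_Suc mult.assoc iota_left_comm)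
qed simp

lemma X_comm_T:
  "j < n \<Longrightarrow> k \<le> n \<Longrightarrow> j \<noteq> k \<Longrightarrow> Suc j \<noteq> k \<Longrightarrow> X k * T j = T j * X k"
  using X_comm_T_gt[of k j] X_comm_T_less[of j k] by linarith

text \<open>The image of the algebra of rank \<open>m\<close>. Elements are kept unreduced, without
  any bound on exponents; \<open>alg 0\<close> consists of scalars and serves the base case of
  \<open>F_mono\<close>.\<close>

inductive_set alg :: "nat \<Rightarrow> 'a set" for m where
  T: "i < m \<Longrightarrow> T i \<in> alg m"
| iota: "\<iota> c \<in> alg m"
| add: "x \<in> alg m \<Longrightarrow> y \<in> alg m \<Longrightarrow> x + y \<in> alg m"
| mult: "x \<in> alg m \<Longrightarrow> y \<in> alg m \<Longrightarrow> x * y \<in> alg m"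

lemma alg_1: "1 \<in> alg m"
  using alg.iota[of 1] by simp

lemma alg_mono: "x \<in> alg l \<Longrightarrow> l \<le> m \<Longrightarrow> x \<in> alg m"
  by (induction rule: alg.induct) (auto intro: alg.intros)

lemma alg_prod_list: "(\<And>x. x \<in> set xs \<Longrightarrow> x \<in> alg m) \<Longrightarrow> prod_list xs \<in> alg m"
  by (induction xs) (auto intro: alg.mult alg_1)

lemma alg_power: "x \<in> alg m \<Longrightarrow> x ^ e \<in> alg m"
  by (induction e) (auto intro: alg.mult alg_1)

lemma X_alg: "1 \<le> k \<Longrightarrow> k \<le> m \<Longrightarrow> X k \<in> alg m"
proof (induction k rule: dec_induct)
  case base
  then show ?case by (auto intro: alg.T)
next
  case (step k)
  then show ?case by (auto simp: X_Suc intro!: alg.intros)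
qed

text \<open>\<open>X k\<close> commutes with every \<open>T i\<close> except possibly
  \<open>i = k\<close> and \<open>Suc i = k\<close>, and neither of these is a generator of
  \<open>alg m\<close> when \<open>m < k\<close>.\<close>

lemma alg_comm_X: "x \<in> alg m \<Longrightarrow> m < k \<Longrightarrow> k \<le> n \<Longrightarrow> x * X k = X k * x"
proof (induction rule: alg.induct)
  case (T i)
  then show ?case using X_comm_T[of i k] by simp
next
  case (mult x y)
  then show ?case by (metis mult.assoc)
qed (auto simp: iota_comm distrib_left distrib_right)

lemma X_comm_X: "j \<le> n \<Longrightarrow> k \<le> n \<Longrightarrow> X j * X k = X k * X j"
proof (induction j k rule: linorder_wlog)
  case (le j k)
  then show ?case using alg_comm_X[OF X_alg[of j j], of k]
    by (cases "j = 0"; cases "j = k") auto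
qed simp

definition monomial :: "nat \<Rightarrow> (nat \<Rightarrow> nat) \<Rightarrow> 'a" where
  "monomial m c = prod_list (map (\<lambda>j. X j ^ c j) [1..<m + 1])"

lemma monomial_0 [simp]: "monomial 0 c = 1"
  and monomial_Suc: "monomial (Suc m) c = monomial m c * X (Suc m) ^ c (Suc m)"
  by (simp_all add: monomial_def)

lemma monomial_zero [simp]: "monomial m (\<lambda>_. 0) = 1"
  by (induction m) (auto simp: monomial_Suc)

lemma monomial_cong: "(\<And>j. j \<in> {1..m} \<Longrightarrow> c j = c' j) \<Longrightarrow> monomial m c = monomial m c'"
  by (induction m) (auto simp: monomial_Suc)

lemma comm_mono:
  "(\<And>j. j \<in> {1..m} \<Longrightarrow> c j \<noteq> 0 \<Longrightarrow> y * X j = X j * y) \<Longrightarrow> y * monomial m c = monomial m c * y"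
proof (induction m)
  case (Suc m)
  then have IH: "y * monomial m c = monomial m c * y" by auto
  have "y * X (Suc m) ^ c (Suc m) = X (Suc m) ^ c (Suc m) * y"
  proof (cases "c (Suc m) = 0")
    case False
    then have "X (Suc m) * y = y * X (Suc m)" using Suc.prems[of "Suc m"] by simp
    then show ?thesis using power_commuting_commutes by metis
  qed simp
  then show ?case using IH unfolding monomial_Suc by (metis mult.assoc)
qed simp

lemma monomial_mult: "m \<le> n \<Longrightarrow> monomial m c * monomial m c' = monomial m (\<lambda>j. c j + c' j)"
proof (induction m)
  case (Suc m)
  have "X j * X (Suc m) ^ e = X (Suc m) ^ e * X j" if "j \<in> {1..m}" for j e
    using power_commuting_commutes[OF X_comm_X[of "Suc m" j]] that Suc.prems by simp
  then have "X (Suc m) ^ c (Suc m) * monomial m c' = monomial m c' * X (Suc m) ^ c (Suc m)"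
    by (intro comm_mono) auto
  then have "monomial (Suc m) c * monomial (Suc m) c'
      = monomial m c * monomial m c' * (X (Suc m) ^ c (Suc m) * X (Suc m) ^ c' (Suc m))"
    unfolding monomial_Suc by (metis mult.assoc)
  then show ?case using Suc by (simp add: monomial_Suc power_add)
qed simp

lemma monomial_single:
  assumes "k \<in> {1..m}"
  shows "monomial m (\<lambda>j. if j = k then e else 0) = X k ^ e"
  using assms
proof (induction m)
  case (Suc m)
  show ?case
  proof (cases "k = Suc m")
    case True
    then have "monomial m (\<lambda>j. if j = k then e else 0) = monomial m (\<lambda>_. 0)" by (intro monomial_cong) auto
    then show ?thesis using True by (simp add: monomial_Suc)
  next
    case False
    then show ?thesis using Suc by (simp add: monomial_Suc)
  qed
qed simp

lemma monomial_alg: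
  assumes "\<And>j. j \<notin> {1..l} \<Longrightarrow> c j = 0"
  shows "monomial m c \<in> alg l"
  unfolding monomial_def
proof (rule alg_prod_list)
  fix x assume "x \<in> set (map (\<lambda>j. X j ^ c j) [1..<m + 1])"
  then obtain j where "x = X j ^ c j" by auto
  then show "x \<in> alg l" using assms[of j] by (cases "j \<in> {1..l}") (auto intro!: alg_power X_alg alg_1)
qed

text \<open>The exponents c' that can occur when T i is moved past the monomial with exponents c.\<close>

definition swp :: "nat \<Rightarrow> (nat \<Rightarrow> nat) \<Rightarrow> (nat \<Rightarrow> nat) \<Rightarrow> bool" where
  "swp i c c' \<longleftrightarrow> (\<forall>j. j \<noteq> i \<longrightarrow> j \<noteq> Suc i \<longrightarrow> c' j = c j) \<and> c' i + c' (Suc i) = c i + c (Suc i) \<and>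
     c' i \<le> max (c i) (c (Suc i)) \<and> c' (Suc i) \<le> max (c i) (c (Suc i))"

abbreviation "upd i c a b \<equiv> c(i := a, Suc i := b)"

text \<open>Isolates the two variables that \<open>T i\<close> acts on; the cofactor commutes with
  \<open>T i\<close>, so the two-variable formulas apply.\<close>

lemma monomial_upd:
  assumes "i \<in> {1..<n}"
  shows "monomial n (upd i c a b) = X i ^ a * X (Suc i) ^ b * monomial n (upd i c 0 0)"
proof -
  have "X i ^ a * X (Suc i) ^ b * monomial n (upd i c 0 0)
      = monomial n (\<lambda>j. if j = i then a else 0) * monomial n (\<lambda>j. if j = Suc i then b else 0) * monomial n (upd i c 0 0)"
    using assms by (simp add: monomial_single)
  also have "\<dots> = monomial n (upd i c a b)"
    by (simp add: monomial_mult) (rule monomial_cong, auto)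
  finally show ?thesis by simp
qed

text \<open>Multiply \<open>X (Suc i)\<close>, written as a scalar times
  \<open>T i * X i * T i\<close>, by \<open>T i\<close> on the right or on the left and resolve the
  square with the quadratic relation.\<close>

lemma X_T_relations:
  assumes "i \<in> {1..<n}"
  shows "T i * X i = X (Suc i) * T i - \<iota> (q - 1) * X (Suc i)"
    and "T i * X (Suc i) = X i * T i + \<iota> (q - 1) * X (Suc i)"
proof -
  let ?a = "\<iota> (q - 1)" and ?b = "\<iota> (rinv q)"
  have XS: "X (Suc i) = ?b * (T i * X i * T i)" using X_Suc assms by simp
  have e1: "P * (T i * T i) = ?a * (P * T i) + \<iota> q * P" for P
    unfolding T_sq[OF assms] by (simp only: distrib_left iota_left_comm iota_comm[of q P])
  have e2: "(T i * T i) * P = ?a * (T i * P) + \<iota> q * P" for P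
    unfolding T_sq[OF assms] by (simp only: distrib_right mult.assoc)
  have ab: "?b * (?a * P) = ?a * (?b * P)" for P by (rule iota_left_comm)
  have bq: "?b * (\<iota> q * P) = P" for P by (simp only: mult.assoc[symmetric] iota_rinv_q mult_1_left)
  have "X (Suc i) * T i = ?b * (T i * X i * (T i * T i))"
    by (simp only: XS mult.assoc)
  also have "\<dots> = ?a * X (Suc i) + T i * X i"
    unfolding e1 XS by (simp only: distrib_left ab bq)
  finally show "T i * X i = X (Suc i) * T i - ?a * X (Suc i)" by simp
  have "T i * X (Suc i) = ?b * ((T i * T i) * (X i * T i))"
    by (simp only: XS mult.assoc iota_left_comm[of "T i"])
  also have "\<dots> = ?a * X (Suc i) + X i * T i"
    unfolding e2 XS by (simp only: distrib_left ab bq mult.assoc)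
  finally show "T i * X (Suc i) = X i * T i + ?a * X (Suc i)" by simp
qed

lemma T_comm_upd: "i \<in> {1..<n} \<Longrightarrow> T i * monomial n (upd i c 0 0) = monomial n (upd i c 0 0) * T i"
  by (rule comm_mono) (auto simp: X_comm_T split: if_splits)

text \<open>Keeps the leading term, with the two exponents exchanged, apart from the corrections.
  The clause \<open>0 < h\<close> is the source of the positivity condition in
  \<open>monomial_T\<close>.\<close>

lemma T_mono_upd:
  assumes i: "i \<in> {1..<n}"
  obtains s where "T i * monomial n c = monomial n (upd i c (c (Suc i)) (c i)) * T i + s"
    and "s \<in> sp {monomial n (upd i c g h) | g h. g + h = c i + c (Suc i) \<and> 0 < h \<and>
      g \<le> max (c i) (c (Suc i)) \<and> h \<le> max (c i) (c (Suc i))}"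
proof -
  let ?S = "{monomial n (upd i c g h) | g h. g + h = c i + c (Suc i) \<and> 0 < h \<and>
      g \<le> max (c i) (c (Suc i)) \<and> h \<le> max (c i) (c (Suc i))}"
  let ?x = "X i" and ?y = "X (Suc i)" and ?k = "\<iota> (q - 1)" and ?M = "monomial n (upd i c 0 0)"
  define a b where "a = c i" and "b = c (Suc i)"
  have xy: "?x * ?y = ?y * ?x" using X_comm_X i by simp
  note obt = that
  note D = demazure_le demazure_ge
  note D = D[OF X_T_relations[OF i] xy iota_comm iota_comm]
  \<comment> \<open>Both orders of the exponents have this shape; in the case \<open>b < a\<close>
    the minus sign is absorbed into the scalar \<open>1 - q\<close>.\<close>
  have fin: thesis if e: "T i * (?x ^ a * ?y ^ b) = ?x ^ b * ?y ^ a * T i + \<iota> z * (\<Sum>g\<in>G. ?x ^ e g * ?y ^ f g)"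
    and G: "\<And>g. g \<in> G \<Longrightarrow> e g + f g = a + b \<and> 0 < f g \<and> e g \<le> max a b \<and> f g \<le> max a b"
  for z and G :: "nat set" and e f
  proof (rule obt)
    have "T i * monomial n c = T i * (?x ^ a * ?y ^ b) * ?M"
      using monomial_upd[OF i, of c a b] by (simp add: a_def b_def mult.assoc)
    also have "\<dots> = ?x ^ b * ?y ^ a * (T i * ?M) + \<iota> z * (\<Sum>g\<in>G. ?x ^ e g * ?y ^ f g * ?M)"
      unfolding e by (simp add: distrib_right mult.assoc sum_distrib_right)
    also have "?x ^ b * ?y ^ a * (T i * ?M) = monomial n (upd i c b a) * T i"
      unfolding T_comm_upd[OF i] monomial_upd[OF i, of c b a] by (simp add: mult.assoc)
    also have "(\<Sum>g\<in>G. ?x ^ e g * ?y ^ f g * ?M) = (\<Sum>g\<in>G. monomial n (upd i c (e g) (f g)))"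
      by (rule sum.cong) (simp_all only: monomial_upd[OF i, symmetric])
    finally show "T i * monomial n c = monomial n (upd i c (c (Suc i)) (c i)) * T i
        + \<iota> z * (\<Sum>g\<in>G. monomial n (upd i c (e g) (f g)))"
      unfolding a_def b_def .
    show "\<iota> z * (\<Sum>g\<in>G. monomial n (upd i c (e g) (f g))) \<in> sp ?S"
      by (rule lin_span.scale, rule lin_span_sum, rule lin_span.base) (use G in \<open>auto simp: a_def b_def\<close>)
  qed
  show thesis
  proof (cases "a \<le> b")
    case True
    show thesis
      by (rule fin[OF D(1)[OF True]]) auto
  next
    case False
    have "T i * (?x ^ a * ?y ^ b) = ?x ^ b * ?y ^ a * T i
        + \<iota> (1 - q) * (\<Sum>g<a - b. ?x ^ (g + b) * ?y ^ (a - g))"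
      using D(2)[of b a] False by (simp add: algebra_simps)
    then show thesis by (rule fin) (use False in auto)
  qed
qed

lemma T_mono:
  assumes "i \<in> {1..<n}"
  shows "T i * monomial n c \<in> sp ({monomial n c' * T i | c'. swp i c c'} \<union> {monomial n c' | c'. swp i c c'})"
proof -
  obtain s where e: "T i * monomial n c = monomial n (upd i c (c (Suc i)) (c i)) * T i + s"
    and s: "s \<in> sp {monomial n (upd i c g h) | g h. g + h = c i + c (Suc i) \<and> 0 < h \<and>
      g \<le> max (c i) (c (Suc i)) \<and> h \<le> max (c i) (c (Suc i))}"
    using T_mono_upd[OF assms] by blast
  show ?thesis unfolding e
  proof (rule lin_span.add)
    show "s \<in> sp ({monomial n c' * T i | c'. swp i c c'} \<union> {monomial n c' | c'. swp i c c'})"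
    proof (rule lin_span_subset[OF s], rule lin_span.base)
      fix y assume "y \<in> {monomial n (upd i c g h) | g h. g + h = c i + c (Suc i) \<and> 0 < h \<and>
        g \<le> max (c i) (c (Suc i)) \<and> h \<le> max (c i) (c (Suc i))}"
      then obtain g h where y: "y = monomial n (upd i c g h)"
        and gh: "g + h = c i + c (Suc i)" "g \<le> max (c i) (c (Suc i))" "h \<le> max (c i) (c (Suc i))"
        by blast
      have "swp i c (upd i c g h)" using gh by (auto simp: swp_def)
      then show "y \<in> {monomial n c' * T i | c'. swp i c c'} \<union> {monomial n c' | c'. swp i c c'}"
        unfolding y by blast
    qed
    have "swp i c (upd i c (c (Suc i)) (c i))" by (simp add: swp_def)
    then show "monomial n (upd i c (c (Suc i)) (c i)) * T i
      \<in> sp ({monomial n c' * T i | c'. swp i c c'} \<union> {monomial n c' | c'. swp i c c'})"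
      by (intro lin_span.base) blast
  qed
qed

text \<open>Apply \<open>T_mono_upd\<close> to the exchanged exponents \<open>c0\<close> and solve
  for the leading term. In \<open>c0\<close> the exponent \<open>c i\<close> sits at
  \<open>Suc i\<close>, and every correction has a positive exponent there; hence the extra
  condition, which monomials moved by \<open>T_mono\<close> do not record.\<close>

lemma monomial_T:
  assumes "i \<in> {1..<n}"
  shows "monomial n c * T i \<in> sp ({T i * monomial n c' | c'. swp i c c' \<and> (c i > 0 \<longrightarrow> c' (Suc i) > 0)}
      \<union> {monomial n c' | c'. swp i c c' \<and> (c i > 0 \<longrightarrow> c' (Suc i) > 0)})" (is "_ \<in> sp ?U")
proof -
  define c0 where "c0 = upd i c (c (Suc i)) (c i)"
  obtain s where e: "T i * monomial n c0 = monomial n (upd i c0 (c0 (Suc i)) (c0 i)) * T i + s"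
    and s: "s \<in> sp {monomial n (upd i c0 g h) | g h. g + h = c0 i + c0 (Suc i) \<and> 0 < h \<and>
      g \<le> max (c0 i) (c0 (Suc i)) \<and> h \<le> max (c0 i) (c0 (Suc i))}"
    using T_mono_upd[OF assms] by blast
  have "upd i c0 (c0 (Suc i)) (c0 i) = c" by (auto simp: c0_def)
  then have e': "monomial n c * T i = T i * monomial n c0 - s" using e by simp
  show ?thesis unfolding e'
  proof (rule sp_diff)
    show "s \<in> sp ?U"
    proof (rule lin_span_subset[OF s], rule lin_span.base)
      fix y assume "y \<in> {monomial n (upd i c0 g h) | g h. g + h = c0 i + c0 (Suc i) \<and> 0 < h \<and>
        g \<le> max (c0 i) (c0 (Suc i)) \<and> h \<le> max (c0 i) (c0 (Suc i))}"
      then obtain g h where y: "y = monomial n (upd i c0 g h)"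
        and gh: "g + h = c0 i + c0 (Suc i)" "0 < h" "g \<le> max (c0 i) (c0 (Suc i))" "h \<le> max (c0 i) (c0 (Suc i))"
        by blast
      have "swp i c (upd i c0 g h) \<and> (c i > 0 \<longrightarrow> upd i c0 g h (Suc i) > 0)"
        using gh by (auto simp: swp_def c0_def)
      then show "y \<in> ?U" unfolding y by (intro UnI2 CollectI exI[of _ "upd i c0 g h"]) simp
    qed
    have "swp i c c0 \<and> (c i > 0 \<longrightarrow> c0 (Suc i) > 0)" by (simp add: swp_def c0_def)
    then show "T i * monomial n c0 \<in> sp ?U"
      by (intro lin_span.base UnI1 CollectI exI[of _ c0]) simp
  qed
qed

abbreviation "r \<equiv> length Qs"

lemma Tw_word:
  assumes "w permutes {1..m}" "m \<le> n"
  obtains ws where "set ws \<subseteq> {1..<m}" "reduced_word n w ws"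
proof -
  obtain ws where "reduced_word m w ws" using assms reduced_word_ex by blast
  then have "set ws \<subseteq> {1..<m}" "perm_of_word ws = w" "length ws = ninv w"
    by (auto simp: reduced_word_iff)
  moreover have "{1..<m} \<subseteq> {1..<n}" using assms by auto
  ultimately show thesis using that[of ws] unfolding reduced_word_iff by blast
qed

lemma Tw_stp: "i \<in> {1..<n} \<Longrightarrow> Tw T n (stp i) = T i"
  using Tw_asc[of id i] permutes_id[of "{1..n}"] by (simp add: permutes_def)

text \<open>A left ascent lengthens the permutation, and a left descent is brought back to one by
  the quadratic relation. Keeping \<open>m\<close> apart from \<open>n\<close> confines the result
  to the smaller symmetric group, as is needed for normal forms of \<open>alg m\<close>.\<close>

lemma T_Tw:
  assumes "w permutes {1..m}" "m \<le> n" "i \<in> {1..<m}"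
  shows "T i * Tw T n w \<in> sp {Tw T n v | v. v permutes {1..m}}"
proof -
  have asc: "T i * Tw T n v = Tw T n (stp i \<circ> v)"
    if v: "v permutes {1..m}" and lt: "inv v i < inv v (Suc i)" for v
  proof -
    have vi: "inv v (v j) = j" for j using v by (simp add: permutes_inverses)
    have "Tw T n (stp i) * Tw T n v = Tw T n (stp i \<circ> v)"
    proof (rule Tw_comp)
      show "stp i permutes {1..n}" using assms by (intro stp_permutes) auto
      show "v permutes {1..n}" using v assms permutes_subset[of v "{1..m}" "{1..n}"] by auto
      fix a b :: nat assume "a < b" "v b < v a"
      moreover from this have "(v b, v a) \<noteq> (i, Suc i)" using lt vi by (metis Pair_inject less_asym)
      ultimately show "stp i (v b) < stp i (v a)" using stp_less by blast
    qed
    then show ?thesis using Tw_stp[of i] assms by simp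
  qed
  let ?w = "stp i \<circ> w"
  have p: "?w permutes {1..m}" using assms stp_permutes permutes_compose by blast
  have pi: "inv w permutes {1..m}" using assms permutes_inv by blast
  show ?thesis
  proof (cases "inv w i < inv w (Suc i)")
    case True
    show ?thesis unfolding asc[OF assms(1) True] using p by (intro lin_span.base) blast
  next
    case False
    have iv: "inv w \<circ> stp i = inv ?w"
      by (rule inv_perm[OF p]) (use permutes_inverses[OF assms(1)] in \<open>auto simp: fun_eq_iff\<close>)
    have "inv ?w i < inv ?w (Suc i)"
      using False permutes_asc_desc[OF pi, of i] iv[symmetric] by auto
    from asc[OF p this] have e: "Tw T n w = T i * Tw T n ?w" by (simp add: o_assoc)
    have "T i * Tw T n w = (T i * T i) * Tw T n ?w" unfolding e by (simp add: mult.assoc)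
    also have "\<dots> = \<iota> (q - 1) * Tw T n w + \<iota> q * Tw T n ?w"
      using T_sq[of i] assms unfolding e by (simp add: distrib_right mult.assoc)
    finally have e': "T i * Tw T n w = \<iota> (q - 1) * Tw T n w + \<iota> q * Tw T n ?w" .
    show ?thesis unfolding e'
      by (rule lin_span.add; rule lin_span.scale; rule lin_span.base) (use p assms in blast)+
  qed
qed

lemma Tw_T_desc:
  assumes "w permutes {1..n}" "i \<in> {1..<n}" "w (Suc i) < w i"
  shows "Tw T n w * T i = \<iota> (q - 1) * Tw T n w + \<iota> q * Tw T n (w \<circ> stp i)"
proof -
  have e: "Tw T n w = Tw T n (w \<circ> stp i) * T i"
    using Tw_asc[of "w \<circ> stp i" i] permutes_comp_stp assms by simp
  have "Tw T n w * T i = Tw T n (w \<circ> stp i) * (T i * T i)" unfolding e by (simp add: mult.assoc)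
  also have "\<dots> = \<iota> (q - 1) * Tw T n w + \<iota> q * Tw T n (w \<circ> stp i)"
    unfolding e T_sq[OF assms(2)] by (simp only: distrib_left iota_left_comm iota_comm[symmetric])
  finally show ?thesis .
qed

lemma Tw_T:
  assumes "w permutes {1..n}" "i \<in> {1..<n}"
  shows "Tw T n w * T i \<in> sp {Tw T n v | v. v permutes {1..n}}"
proof (cases "w i < w (Suc i)")
  case True
  show ?thesis unfolding Tw_asc[OF assms True] using permutes_comp_stp[OF assms] by (intro lin_span.base) blast
next
  case False
  then have d: "w (Suc i) < w i" using permutes_asc_desc[OF assms(1), of i] by simp
  show ?thesis unfolding Tw_T_desc[OF assms d]
    by (rule lin_span.add; rule lin_span.scale; rule lin_span.base)
      (use permutes_comp_stp[OF assms] assms(1) in blast)+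
qed

section \<open>The trace and its kernel\<close>

definition nf :: "nat \<Rightarrow> (nat \<Rightarrow> nat) set" where
  "nf m = {c. (\<forall>j. c j < r) \<and> (\<forall>j. j \<notin> {1..m} \<longrightarrow> c j = 0)}"

text \<open>The predicate \<open>C\<close> lets one construction serve twice: the trivial
  \<open>C\<close> gives a spanning set for \<open>alg m\<close>, and \<open>C\<close> expressing a
  nonzero exponent vector gives \<open>N\<close>.\<close>

definition bspan :: "nat \<Rightarrow> ((nat \<Rightarrow> nat) \<Rightarrow> bool) \<Rightarrow> 'a set" where
  "bspan m C = sp {monomial n c * Tw T n w | c w. c \<in> nf m \<and> C c \<and> w permutes {1..m}}"

lemma bspan_base: "c \<in> nf m \<Longrightarrow> C c \<Longrightarrow> w permutes {1..m} \<Longrightarrow> monomial n c * Tw T n w \<in> bspan m C"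
  unfolding bspan_def by (rule lin_span.base) blast

lemma r_pos: "0 < r"
  using Qs by simp

lemma one_bspan: "1 \<in> bspan m (\<lambda>_. True)"
proof -
  have "monomial n (\<lambda>_. 0) * Tw T n id \<in> bspan m (\<lambda>_. True)"
    by (rule bspan_base) (use r_pos in \<open>auto simp: nf_def permutes_def\<close>)
  then show ?thesis by (simp only: monomial_zero Tw_id mult_1_left)
qed

lemma nf_swp: "c \<in> nf m \<Longrightarrow> swp i c c' \<Longrightarrow> i \<in> {1..<m} \<Longrightarrow> c' \<in> nf m"
proof -
  assume c: "c \<in> nf m" and s: "swp i c c'" and i: "i \<in> {1..<m}"
  have "c' j < r \<and> (j \<notin> {1..m} \<longrightarrow> c' j = 0)" for j
  proof (cases "j = i \<or> j = Suc i")
    case True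
    have "c i < r" "c (Suc i) < r" using c by (auto simp: nf_def)
    then have "c' i < r" "c' (Suc i) < r" using s by (auto simp: swp_def)
    then show ?thesis using True i by auto
  next
    case False
    then show ?thesis using s c by (auto simp: swp_def nf_def)
  qed
  then show ?thesis by (simp add: nf_def)
qed

text \<open>No relation of degree \<open>r\<close> is ever invoked: \<open>swp\<close> does not
  raise the maximal exponent, so everything stays in normal form and any property stable under
  \<open>swp\<close> survives.\<close>

lemma T_bspan:
  assumes "x \<in> bspan m C" "i \<in> {1..<m}" "m \<le> n" and C: "\<And>c c'. C c \<Longrightarrow> swp i c c' \<Longrightarrow> C c'"
  shows "T i * x \<in> bspan m C"
  using assms(1) unfolding bspan_def
proof (rule sp_mult_left)
  fix v assume "v \<in> {monomial n c * Tw T n w | c w. c \<in> nf m \<and> C c \<and> w permutes {1..m}}"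
  then obtain c w where v: "v = monomial n c * Tw T n w" "c \<in> nf m" "C c" "w permutes {1..m}" by blast
  have "T i * monomial n c * Tw T n w \<in> sp {monomial n c * Tw T n w | c w. c \<in> nf m \<and> C c \<and> w permutes {1..m}}"
  proof (rule sp_mult_right[OF T_mono[of i c]])
    show "i \<in> {1..<n}" using assms by auto
    fix z assume "z \<in> {monomial n c' * T i |c'. swp i c c'} \<union> {monomial n c' |c'. swp i c c'}"
    then obtain c' where c': "swp i c c'" and z: "z = monomial n c' * T i \<or> z = monomial n c'" by blast
    have g: "c' \<in> nf m" "C c'" using v nf_swp[OF v(2) c'] C[OF v(3) c'] assms by auto
    from z have "z * Tw T n w \<in> bspan m C"
    proof
      assume "z = monomial n c' * T i"
      moreover have "monomial n c' * (T i * Tw T n w) \<in> bspan m C" unfolding bspan_def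
        by (rule sp_mult_left[OF T_Tw[OF v(4) assms(3,2)]]) (use g bspan_base[of c' m C] in \<open>auto simp: bspan_def\<close>)
      ultimately show ?thesis by (simp add: mult.assoc)
    qed (use g v bspan_base in auto)
    then show "z * Tw T n w \<in> sp {monomial n c * Tw T n w | c w. c \<in> nf m \<and> C c \<and> w permutes {1..m}}"
      unfolding bspan_def .
  qed
  then show "T i * v \<in> sp {monomial n c * Tw T n w | c w. c \<in> nf m \<and> C c \<and> w permutes {1..m}}"
    unfolding v by (simp add: mult.assoc)
qed

lemma bspan_T:
  assumes "x \<in> bspan n C" "i \<in> {1..<n}"
  shows "x * T i \<in> bspan n C"
  using assms(1) unfolding bspan_def
proof (rule sp_mult_right)
  fix v assume "v \<in> {monomial n c * Tw T n w | c w. c \<in> nf n \<and> C c \<and> w permutes {1..n}}"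
  then obtain c w where v: "v = monomial n c * Tw T n w" "c \<in> nf n" "C c" "w permutes {1..n}" by blast
  have "monomial n c * (Tw T n w * T i) \<in> bspan n C" unfolding bspan_def
    by (rule sp_mult_left[OF Tw_T[OF v(4) assms(2)]]) (use v bspan_base[of c n C] in \<open>auto simp: bspan_def\<close>)
  then show "v * T i \<in> sp {monomial n c * Tw T n w | c w. c \<in> nf n \<and> C c \<and> w permutes {1..n}}"
    unfolding v bspan_def by (simp add: mult.assoc)
qed

lemma prod_linear_factors:
  "\<exists>s\<in>sp {x ^ g | g. g < length zs}. prod_list (map (\<lambda>z. x - \<iota> z) zs) = x ^ length zs + s"
proof (induction zs)
  case Nil
  show ?case by (auto intro: lin_span.zero)
next
  case (Cons z zs)
  then obtain s where s: "s \<in> sp {x ^ g | g. g < length zs}"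
    and e: "prod_list (map (\<lambda>z. x - \<iota> z) zs) = x ^ length zs + s" by blast
  let ?S = "{x ^ g | g. g < length (z # zs)}"
  have "x * s \<in> sp ?S"
    by (rule sp_mult_left[OF s], rule lin_span.base) (force simp: power_Suc[symmetric] simp del: power_Suc)
  moreover have "\<iota> z * s \<in> sp ?S"
    by (rule lin_span.scale, rule lin_span_subset[OF s], rule lin_span.base) force
  moreover have "\<iota> z * x ^ length zs \<in> sp ?S"
    by (rule lin_span.scale, rule lin_span.base) force
  ultimately have "x * s - \<iota> z * s - \<iota> z * x ^ length zs \<in> sp ?S" by (intro sp_diff)
  moreover have "prod_list (map (\<lambda>z. x - \<iota> z) (z # zs)) = x ^ length (z # zs) + (x * s - \<iota> z * s - \<iota> z * x ^ length zs)"
    using e by (simp add: algebra_simps)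
  ultimately show ?case by blast
qed

lemma X1_power_r: "X 1 ^ r \<in> sp {X 1 ^ g | g. g < r}"
proof -
  have "prod_list (map (\<lambda>z. T 0 - \<iota> z) Qs) = 0"
    using AK unfolding AK_algebra_def by blast
  then obtain s where s: "s \<in> sp {X 1 ^ g | g. g < r}" "0 = X 1 ^ r + s"
    using prod_linear_factors[of "X 1" Qs] by auto
  then have "X 1 ^ r = - s" by (metis eq_neg_iff_add_eq_0)
  then show ?thesis using s sp_minus by simp
qed

text \<open>Here \<open>X 1 ^ r\<close> may have to be expanded into lower powers, the constant
  included. Hence no condition on the exponents is kept, in contrast to
  \<open>T_bspan\<close>.\<close>

lemma T0_bspan:
  assumes "x \<in> bspan m (\<lambda>_. True)" "0 < m" "m \<le> n"
  shows "T 0 * x \<in> bspan m (\<lambda>_. True)"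
  using assms(1) unfolding bspan_def
proof (rule sp_mult_left)
  fix v assume "v \<in> {monomial n c * Tw T n w | c w. c \<in> nf m \<and> True \<and> w permutes {1..m}}"
  then obtain c w where v: "v = monomial n c * Tw T n w" "c \<in> nf m" "w permutes {1..m}" by blast
  let ?c = "\<lambda>g. c(1 := g)"
  have c1: "X 1 ^ g * monomial n (?c h) = monomial n (?c (g + h))" for g h
  proof -
    have "X 1 ^ g * monomial n (?c h) = monomial n (\<lambda>j. if j = 1 then g else 0) * monomial n (?c h)"
      using monomial_single[of 1 n g] n1 by simp
    also have "\<dots> = monomial n (?c (g + h))" by (simp add: monomial_mult) (rule monomial_cong, auto)
    finally show ?thesis .
  qed
  have b: "monomial n (?c g) * Tw T n w \<in> bspan m (\<lambda>_. True)" if "g < r" for g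
    using that v assms by (intro bspan_base) (auto simp: nf_def)
  have T0: "T 0 * v = monomial n (?c (Suc (c 1))) * Tw T n w"
    using c1[of 1 "c 1"] unfolding v by (simp add: mult.assoc[symmetric])
  have "T 0 * v \<in> bspan m (\<lambda>_. True)"
  proof (cases "Suc (c 1) < r")
    case True
    then show ?thesis unfolding T0 by (rule b)
  next
    case False
    moreover have "c 1 < r" using v by (auto simp: nf_def)
    ultimately have "Suc (c 1) = r" by simp
    then have "T 0 * v = X 1 ^ r * (monomial n (?c 0) * Tw T n w)"
      using c1[of r 0] unfolding T0 by (simp add: mult.assoc[symmetric])
    also have "\<dots> \<in> bspan m (\<lambda>_. True)" unfolding bspan_def
    proof (rule sp_mult_right[OF X1_power_r])
      fix z assume "z \<in> {X 1 ^ g |g. g < r}"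
      then obtain g where "g < r" "z = X 1 ^ g" by blast
      then show "z * (monomial n (?c 0) * Tw T n w)
        \<in> sp {monomial n c * Tw T n w |c w. c \<in> nf m \<and> True \<and> w permutes {1..m}}"
        using b[of g] c1[of g 0] by (simp add: mult.assoc[symmetric] bspan_def)
    qed
    finally show ?thesis .
  qed
  then show "T 0 * v \<in> sp {monomial n c * Tw T n w | c w. c \<in> nf m \<and> True \<and> w permutes {1..m}}"
    unfolding bspan_def .
qed

text \<open>The generators preserve the normal forms of rank \<open>m\<close>. Applied to
  \<open>x = 1\<close>, this rewrites any element of \<open>alg m\<close>, however large its
  exponents, in the first \<open>m\<close> variables and the permutations of \<open>{1..m}\<close>
  alone.\<close>

lemma alg_bspan:
  assumes "y \<in> alg m" "m \<le> n" "x \<in> bspan m (\<lambda>_. True)"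
  shows "y * x \<in> bspan m (\<lambda>_. True)"
  using assms(1,3)
proof (induction arbitrary: x rule: alg.induct)
  case (T i)
  then show ?case using T0_bspan[of x m] T_bspan[of x m "\<lambda>_. True" i] assms by (cases "i = 0") auto
next
  case (iota c)
  then show ?case unfolding bspan_def by (rule lin_span.scale)
next
  case (add y z)
  then show ?case unfolding bspan_def by (auto simp: distrib_right intro: lin_span.add)
qed (auto simp: mult.assoc)

definition N :: "'a set" where
  "N = bspan n (\<lambda>c. c \<noteq> (\<lambda>_. 0))"

lemma N_add: "x \<in> N \<Longrightarrow> y \<in> N \<Longrightarrow> x + y \<in> N"
  and N_scale: "x \<in> N \<Longrightarrow> \<iota> z * x \<in> N"
  and N_zero: "0 \<in> N"
  unfolding N_def bspan_def by (fact lin_span.intros)+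

lemma swp_nonzero: "swp i c c' \<Longrightarrow> c \<noteq> (\<lambda>_. 0) \<Longrightarrow> c' \<noteq> (\<lambda>_. 0)"
proof
  assume s: "swp i c c'" "c \<noteq> (\<lambda>_. 0)" "c' = (\<lambda>_. 0)"
  have "c j = 0" for j
    using s(1) unfolding s(3) swp_def by (cases "j = i \<or> j = Suc i") auto
  then show False using s by auto
qed

lemma Tp_N: "set ws \<subseteq> {1..<n} \<Longrightarrow> x \<in> N \<Longrightarrow> Tp ws * x \<in> N"
  by (induction ws) (auto simp: N_def mult.assoc intro!: T_bspan dest: swp_nonzero)

lemma N_Tp: "set ws \<subseteq> {1..<n} \<Longrightarrow> x \<in> N \<Longrightarrow> x * Tp ws \<in> N"
proof (induction ws arbitrary: x)
  case (Cons i ws)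
  then have "x * T i \<in> N" by (auto simp: N_def intro!: bspan_T)
  then show ?case using Cons.IH[of "x * T i"] Cons.prems by (simp add: mult.assoc)
qed simp

lemma Tw_N: "w permutes {1..n} \<Longrightarrow> x \<in> N \<Longrightarrow> Tw T n w * x \<in> N"
  using Tw_word[of w n] Tp_N Tw_eq by (metis order_refl)

lemma N_Tw: "w permutes {1..n} \<Longrightarrow> x \<in> N \<Longrightarrow> x * Tw T n w \<in> N"
  using Tw_word[of w n] N_Tp Tw_eq by (metis order_refl)

section \<open>Coordinates and values of the trace\<close>

lemma is_basis_AK: "is_basis \<iota> (AK_basis \<iota> q T n) (AK_index r n)"
  using AK unfolding AK_algebra_def by blast

abbreviation "Tr \<equiv> AK_Tr \<iota> q T r n"
abbreviation "basis_coords \<equiv> coords \<iota> (AK_basis \<iota> q T n) (AK_index r n)"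

lemma coords_spec:
  "(\<forall>i. i \<notin> AK_index r n \<longrightarrow> basis_coords x i = 0) \<and>
    x = (\<Sum>i\<in>AK_index r n. \<iota> (basis_coords x i) * AK_basis \<iota> q T n i)"
proof -
  have "\<exists>!c. (\<forall>i. i \<notin> AK_index r n \<longrightarrow> c i = 0) \<and> x = (\<Sum>i\<in>AK_index r n. \<iota> (c i) * AK_basis \<iota> q T n i)"
    using is_basis_AK unfolding is_basis_def by blast
  from theI'[OF this] show ?thesis unfolding coords_def .
qed

lemma coords_unique:
  assumes "\<And>i. i \<notin> AK_index r n \<Longrightarrow> c i = 0" "x = (\<Sum>i\<in>AK_index r n. \<iota> (c i) * AK_basis \<iota> q T n i)"
  shows "basis_coords x = c"
proof -
  have "\<exists>!c. (\<forall>i. i \<notin> AK_index r n \<longrightarrow> c i = 0) \<and> x = (\<Sum>i\<in>AK_index r n. \<iota> (c i) * AK_basis \<iota> q T n i)"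
    using is_basis_AK unfolding is_basis_def by blast
  then show ?thesis using coords_spec[of x] assms by blast
qed

lemma Tr_add [simp]: "Tr (x + y) = Tr x + Tr y"
proof -
  have "basis_coords (x + y) = (\<lambda>i. basis_coords x i + basis_coords y i)"
    by (rule coords_unique)
      (use coords_spec[of x] coords_spec[of y] in \<open>auto simp: distrib_right sum.distrib\<close>)
  then show ?thesis by (simp add: AK_Tr_def)
qed

lemma Tr_scale [simp]: "Tr (\<iota> z * x) = z * Tr x"
proof -
  have "basis_coords (\<iota> z * x) = (\<lambda>i. z * basis_coords x i)"
  proof (rule coords_unique)
    have "\<iota> z * x = \<iota> z * (\<Sum>i\<in>AK_index r n. \<iota> (basis_coords x i) * AK_basis \<iota> q T n i)"
      using coords_spec[of x] by simp
    then show "\<iota> z * x = (\<Sum>i\<in>AK_index r n. \<iota> (z * basis_coords x i) * AK_basis \<iota> q T n i)"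
      by (simp add: sum_distrib_left mult.assoc)
  qed (use coords_spec[of x] in auto)
  then show ?thesis by (simp add: AK_Tr_def)
qed

lemma Tr_0 [simp]: "Tr 0 = 0"
  using Tr_scale[of 0 0] by simp

lemma Tr_sum: "Tr (sum f I) = (\<Sum>i\<in>I. Tr (f i))"
  by (induction I rule: infinite_finite_induct) auto

lemma Tr_basis:
  assumes "(c, w) \<in> AK_index r n"
  shows "Tr (monomial n c * Tw T n w) = (if c = (\<lambda>_. 0) \<and> w = id then 1 else 0)"
proof -
  have e: "monomial n c * Tw T n w = AK_basis \<iota> q T n (c, w)"
    by (simp add: AK_basis_def monomial_def)
  have "basis_coords (AK_basis \<iota> q T n (c, w)) = (\<lambda>i. if i = (c, w) then 1 else 0)"
  proof (rule coords_unique)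
    have "finite (AK_index r n)" using is_basis_AK unfolding is_basis_def by blast
    then have "AK_basis \<iota> q T n (c, w)
        = (\<Sum>i\<in>AK_index r n. if i = (c, w) then AK_basis \<iota> q T n i else 0)"
      using assms by (simp add: sum.delta)
    also have "\<dots> = (\<Sum>i\<in>AK_index r n. \<iota> (if i = (c, w) then 1 else 0) * AK_basis \<iota> q T n i)"
      by (rule sum.cong) auto
    finally show "AK_basis \<iota> q T n (c, w)
      = (\<Sum>i\<in>AK_index r n. \<iota> (if i = (c, w) then 1 else 0) * AK_basis \<iota> q T n i)" .
  qed (use assms in auto)
  then show ?thesis unfolding e AK_Tr_def by auto
qed

lemma Tr_N: "x \<in> N \<Longrightarrow> Tr x = 0"
  unfolding N_def bspan_def
  by (induction rule: lin_span.induct) (auto simp: Tr_basis AK_index_def nf_def)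

lemma Tr_Tw: "w permutes {1..n} \<Longrightarrow> Tr (Tw T n w) = (if w = id then 1 else 0)"
  using Tr_basis[of "\<lambda>_. 0" w] r_pos by (simp add: AK_index_def)

text \<open>Letters are moved one at a time from the front of \<open>v\<close> to the end of
  \<open>u\<close>, which leaves \<open>u \<circ> v\<close> unchanged.\<close>

lemma Tr_Tw_Tw:
  assumes "u permutes {1..n}" "v permutes {1..n}" "u \<circ> v \<noteq> id"
  shows "Tr (Tw T n u * Tw T n v) = 0"
proof -
  obtain ws where "reduced_word n v ws" using reduced_word_ex assms(2) by blast
  then show ?thesis using assms(1,3)
  proof (induction ws arbitrary: u v)
    case Nil
    then have "v = id" by (simp add: reduced_word_iff)
    then show ?case using Nil by (simp add: Tr_Tw del: id_apply)
  next
    case (Cons i ws)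
    let ?v = "stp i \<circ> v"
    note rc = reduced_word_Cons[OF Cons.prems(1)]
    have i: "i \<in> {1..<n}" by fact
    have p: "?v permutes {1..n}" using rc(2) by (rule reduced_word_permutes)
    have u: "u \<circ> stp i permutes {1..n}" using permutes_comp_stp Cons.prems i by blast
    have "Tw T n v = T i * Tw T n ?v" using Tw_eq[OF Cons.prems(1)] Tw_eq[OF rc(2)] by simp
    then have e: "Tw T n u * Tw T n v = (Tw T n u * T i) * Tw T n ?v" by (simp add: mult.assoc)
    have c: "u \<circ> stp i \<circ> ?v = u \<circ> v" by (simp add: fun_eq_iff)
    have 1: "Tr (Tw T n (u \<circ> stp i) * Tw T n ?v) = 0"
      using Cons.IH[OF rc(2) u] Cons.prems(3) unfolding c by blast
    show ?case
    proof (cases "u i < u (Suc i)")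
      case True
      show ?thesis unfolding e Tw_asc[OF Cons.prems(2) i True] by (rule 1)
    next
      case False
      then have d: "u (Suc i) < u i" using permutes_asc_desc[OF Cons.prems(2), of i] by simp
      \<comment> \<open>The quadratic relation leaves an extra term pairing \<open>u\<close> itself
        with the shortened \<open>?v\<close>. The induction hypothesis covers it, since
        \<open>u = inv ?v\<close> is impossible: \<open>u\<close> has a descent at \<open>i\<close>,
        but \<open>inv ?v\<close> an ascent.\<close>
      have "u \<circ> ?v \<noteq> id"
      proof
        assume "u \<circ> ?v = id"
        then have "u = inv ?v" by (rule inv_perm[OF p])
        then show False using rc(3) d by simp
      qed
      then have "Tr (Tw T n u * Tw T n ?v) = 0" using Cons.IH[OF rc(2)] Cons.prems by blast
      then show ?thesis unfolding e Tw_T_desc[OF Cons.prems(2) i d]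
        using 1 by (simp only: distrib_right mult.assoc Tr_add Tr_scale) simp
    qed
  qed
qed

section \<open>Following a positive exponent along a reduced word\<close>

lemma reduced_word_prefix:
  "reduced_word n w (us @ vs) \<Longrightarrow> reduced_word n (perm_of_word us) us"
proof (induction vs arbitrary: w rule: rev_induct)
  case Nil
  then show ?case by (simp add: reduced_word_iff)
next
  case (snoc i vs)
  then have "reduced_word n w ((us @ vs) @ [i])" by simp
  then show ?case using snoc.IH unfolding reduced_word_snoc_iff by blast
qed

text \<open>
  Along a reduced word an element of the preimage of {1..b} can only move upwards, and in this
  direction every correction term of the commutation relation keeps a positive exponent there.
\<close>

lemma monomial_Tp_track:
  assumes "reduced_word n w (us @ ws)" "set ws \<subseteq> {1..<k}"
    and "perm_of_word us j \<in> {1..b}" "c j > 0"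
    and "\<And>j. c j \<le> \<delta>" "\<And>j. j \<notin> {1..k} \<Longrightarrow> c j = 0"
  shows "monomial n c * Tp ws \<in> sp {Tp vs * monomial n c' | vs c'. set vs \<subseteq> {1..<k} \<and>
    (\<exists>j. w j \<in> {1..b} \<and> c' j > 0) \<and> (\<forall>j. c' j \<le> \<delta>) \<and> (\<forall>j. j \<notin> {1..k} \<longrightarrow> c' j = 0)}"
    (is "_ \<in> sp ?U")
  using assms
proof (induction ws arbitrary: us c j)
  case Nil
  then have "w j \<in> {1..b}" by (auto simp: reduced_word_iff)
  then have "monomial n c * Tp [] = Tp [] * monomial n c \<and> set [] \<subseteq> {1..<k} \<and>
    (\<exists>j. w j \<in> {1..b} \<and> c j > 0) \<and> (\<forall>j. c j \<le> \<delta>) \<and> (\<forall>j. j \<notin> {1..k} \<longrightarrow> c j = 0)"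
    using Nil by auto
  then show ?case by (intro lin_span.base) blast
next
  case (Cons i ws)
  have red: "reduced_word n w ((us @ [i]) @ ws)" using Cons.prems by simp
  have "reduced_word n (perm_of_word (us @ [i])) (us @ [i])"
    using reduced_word_prefix[OF red] .
  then have up: "perm_of_word us i < perm_of_word us (Suc i)" and i: "i \<in> {1..<n}"
    and us: "perm_of_word us permutes {1..n}"
    unfolding reduced_word_snoc_iff using reduced_word_permutes[of n "perm_of_word us" us]
    by (auto simp: reduced_word_snoc_iff[unfolded comp_def] comp_def)
  have ik: "i \<in> {1..<k}" using Cons.prems by simp
  have pos: "1 \<le> perm_of_word us i" using permutes_in_image[OF us, of i] i by auto
  \<comment> \<open>If the tracked position is \<open>i\<close>, it moves to \<open>Suc i\<close>,
    where \<open>monomial_T\<close> guarantees a positive exponent. If it is \<open>Suc i\<close>,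
    the exponent may land on either position; both then lie in the preimage of
    \<open>{1..b}\<close>, because reducedness makes the value at \<open>i\<close> smaller than that
    at \<open>Suc i\<close>.\<close>
  have hit: "\<exists>j. perm_of_word (us @ [i]) j \<in> {1..b} \<and> c' j > 0"
    if s: "swp i c c'" "c i > 0 \<longrightarrow> c' (Suc i) > 0" for c'
  proof -
    consider "j = i" | "j = Suc i" | "j \<noteq> i" "j \<noteq> Suc i" by blast
    then show ?thesis
    proof cases
      case 1
      then show ?thesis using s Cons.prems(3,4) by (intro exI[of _ "Suc i"]) simp
    next
      case 2
      then have "c' i + c' (Suc i) > 0" using s Cons.prems by (simp add: swp_def)
      then show ?thesis using up pos Cons.prems(3) 2
        by (cases "c' i > 0") (auto intro: exI[of _ i] exI[of _ "Suc i"])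
    next
      case 3
      then have "c' j = c j" using s by (simp add: swp_def)
      then show ?thesis using 3 Cons.prems by (intro exI[of _ j]) simp
    qed
  qed
  define P where "P c' \<longleftrightarrow> swp i c c' \<and> (c i > 0 \<longrightarrow> c' (Suc i) > 0)" for c'
  have "monomial n c * T i * Tp ws \<in> sp ?U"
  proof (rule sp_mult_right[OF monomial_T[OF i, of c, folded P_def]])
    fix z assume "z \<in> {T i * monomial n c' | c'. P c'} \<union> {monomial n c' | c'. P c'}"
    then obtain c' where "P c'" and z: "z = T i * monomial n c' \<or> z = monomial n c'" by blast
    then have s: "swp i c c'" "c i > 0 \<longrightarrow> c' (Suc i) > 0" by (auto simp: P_def)
    obtain j' where j': "perm_of_word (us @ [i]) j' \<in> {1..b}" "c' j' > 0" using hit[OF s] by blast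
    have "c' l \<le> \<delta>" for l
    proof (cases "l = i \<or> l = Suc i")
      case True
      have "max (c i) (c (Suc i)) \<le> \<delta>" using Cons.prems(5) by simp
      then show ?thesis using True s by (auto simp: swp_def)
    qed (use s Cons.prems(5) in \<open>auto simp: swp_def\<close>)
    moreover have "c' l = 0" if "l \<notin> {1..k}" for l
      using that s(1) Cons.prems(6)[of l] ik by (auto simp: swp_def)
    ultimately have IH: "monomial n c' * Tp ws \<in> sp ?U"
      using Cons.IH[where us = "us @ [i]" and c = c' and j = j'] red j' Cons.prems(2) by simp
    from z show "z * Tp ws \<in> sp ?U"
    proof
      assume "z = T i * monomial n c'"
      moreover have "T i * (monomial n c' * Tp ws) \<in> sp ?U"
      proof (rule sp_mult_left[OF IH])
        fix v assume "v \<in> ?U"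
        then obtain vs c'' where v: "v = Tp vs * monomial n c''" and c'': "set vs \<subseteq> {1..<k}"
          "\<exists>j. w j \<in> {1..b} \<and> c'' j > 0" "\<forall>j. c'' j \<le> \<delta>" "\<forall>j. j \<notin> {1..k} \<longrightarrow> c'' j = 0" by blast
        have "T i * v = Tp (i # vs) * monomial n c''" by (simp add: v mult.assoc)
        moreover have "set (i # vs) \<subseteq> {1..<k}" using c'' ik by simp
        ultimately show "T i * v \<in> sp ?U" using c'' by (intro lin_span.base) blast
      qed
      ultimately show ?thesis by (simp add: mult.assoc)
    qed (use IH in simp)
  qed
  then show ?case by (simp add: mult.assoc)
qed

section \<open>Moving a polynomial past a block permutation modulo N\<close>

lemma Tw_alg: "w permutes {1..m} \<Longrightarrow> m \<le> n \<Longrightarrow> Tw T n w \<in> alg m"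
proof -
  assume "w permutes {1..m}" "m \<le> n"
  then obtain ws where ws: "set ws \<subseteq> {1..<m}" "reduced_word n w ws" by (rule Tw_word)
  have "T i \<in> alg m" if "i \<in> set ws" for i using subsetD[OF ws(1) that] by (simp add: alg.T)
  then show ?thesis by (auto simp: Tw_eq[OF ws(2)] intro!: alg_prod_list)
qed

lemma alg_comm_mono:
  assumes "y \<in> alg m" "\<And>j. j \<notin> {m+1..n} \<Longrightarrow> e j = 0"
  shows "y * monomial n e = monomial n e * y"
proof (rule comm_mono)
  fix j assume "j \<in> {1..n}" "e j \<noteq> 0"
  then have "m < j" "j \<le> n" using assms(2)[of j] by force+
  then show "y * X j = X j * y" using alg_comm_X assms(1) by blast
qed

text \<open>Rewriting \<open>y\<close> in normal form of rank \<open>m\<close> touches only the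
  first \<open>m\<close> variables, and the \<open>T_w\<close> that occur commute with the monomial
  in the later ones. The exponents therefore add on disjoint supports: no overflow, and the nonzero
  part \<open>e\<close> cannot be destroyed.\<close>

lemma alg_mono_N:
  assumes y: "y \<in> alg m" and m: "m \<le> n" and e: "\<And>j. j \<notin> {m+1..n} \<Longrightarrow> e j = 0"
    and e0: "e \<noteq> (\<lambda>_. 0)" and er: "\<And>j. e j < r"
  shows "y * monomial n e \<in> N"
proof -
  have "y * 1 \<in> bspan m (\<lambda>_. True)" using alg_bspan[OF y m one_bspan] .
  then have "y \<in> sp {monomial n c * Tw T n w | c w. c \<in> nf m \<and> True \<and> w permutes {1..m}}"
    unfolding bspan_def by simp
  then have "y * monomial n e \<in> sp {monomial n c * Tw T n w | c w. c \<in> nf n \<and> c \<noteq> (\<lambda>_. 0) \<and> w permutes {1..n}}"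
  proof (rule sp_mult_right)
    fix v assume "v \<in> {monomial n c * Tw T n w | c w. c \<in> nf m \<and> True \<and> w permutes {1..m}}"
    then obtain c w where v: "v = monomial n c * Tw T n w" "c \<in> nf m" "w permutes {1..m}" by blast
    let ?f = "\<lambda>j. c j + e j"
    have "v * monomial n e = monomial n c * (Tw T n w * monomial n e)" by (simp add: v mult.assoc)
    also have "\<dots> = monomial n c * (monomial n e * Tw T n w)" using alg_comm_mono[OF Tw_alg[OF v(3) m] e] by simp
    also have "\<dots> = monomial n ?f * Tw T n w" by (simp add: monomial_mult mult.assoc[symmetric])
    finally have z: "v * monomial n e = monomial n ?f * Tw T n w" .
    have "w permutes {1..n}" using v(3) m permutes_subset[of w "{1..m}" "{1..n}"] by auto
    moreover have "?f \<noteq> (\<lambda>_. 0)"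
    proof -
      obtain j where "e j \<noteq> 0" using e0 by auto
      then show ?thesis by (auto dest: fun_cong[of _ _ j])
    qed
    moreover have "?f \<in> nf n"
    proof -
      have "?f j < r \<and> (j \<notin> {1..n} \<longrightarrow> ?f j = 0)" for j
      proof (cases "j \<in> {1..m}")
        case True
        then show ?thesis using e[of j] v(2) m by (auto simp: nf_def)
      next
        case False
        then have "c j = 0" using v(2) by (auto simp: nf_def)
        then show ?thesis using er[of j] e[of j] by auto
      qed
      then show ?thesis by (simp add: nf_def)
    qed
    ultimately show "v * monomial n e \<in> sp {monomial n c * Tw T n w | c w. c \<in> nf n \<and> c \<noteq> (\<lambda>_. 0) \<and> w permutes {1..n}}"
      unfolding z by (intro lin_span.base) blast
  qed
  then show ?thesis unfolding N_def bspan_def .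
qed

text \<open>Polynomials with constant term \<open>z\<close> and degree at most \<open>D j\<close> in
  \<open>X j\<close>. The constant term is split off because it is all that survives modulo
  \<open>N\<close>; the exponents need not be below \<open>r\<close>.\<close>

definition pol :: "(nat \<Rightarrow> nat) \<Rightarrow> 'r \<Rightarrow> 'a set" where
  "pol D z = {A. A - \<iota> z \<in> sp {monomial n c | c. c \<noteq> (\<lambda>_. 0) \<and> (\<forall>j. c j \<le> D j)}}"

lemma sp_mono: "x \<in> sp S \<Longrightarrow> S \<subseteq> S' \<Longrightarrow> x \<in> sp S'"
  by (erule lin_span_subset) (auto intro: lin_span.base)

text \<open>Exponents of monomials add without cancellation, so a product with a nonconstant
  monomial is nonconstant and only the two constant terms contribute to the new one.\<close>

lemma pol_mult:
  assumes "A \<in> pol D z" "B \<in> pol E u"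
  shows "A * B \<in> pol (\<lambda>j. D j + E j) (z * u)"
proof -
  let ?S = "\<lambda>D. {monomial n c | c. c \<noteq> (\<lambda>_. 0) \<and> (\<forall>j. c j \<le> D j)}"
  let ?F = "\<lambda>j. D j + E j"
  have 1: "(A - \<iota> z) * (B - \<iota> u) \<in> sp (?S ?F)"
  proof (rule sp_mult)
    show "A - \<iota> z \<in> sp (?S D)" "B - \<iota> u \<in> sp (?S E)" using assms by (auto simp: pol_def)
    fix x y assume "x \<in> ?S D" "y \<in> ?S E"
    then obtain c e where x: "x = monomial n c" "c \<noteq> (\<lambda>_. 0)" "\<forall>j. c j \<le> D j" and y: "y = monomial n e" "\<forall>j. e j \<le> E j"
      by blast
    have "x * y = monomial n (\<lambda>j. c j + e j)" by (simp add: x y monomial_mult)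
    moreover have "(\<lambda>j. c j + e j) \<noteq> (\<lambda>_. 0)"
    proof -
      obtain j where "c j \<noteq> 0" using x by auto
      then show ?thesis by (auto dest: fun_cong[of _ _ j])
    qed
    moreover have "\<forall>j. c j + e j \<le> ?F j" using x y by (auto intro: add_mono)
    ultimately show "x * y \<in> sp (?S ?F)" by (intro lin_span.base) blast
  qed
  have "A - \<iota> z \<in> sp (?S ?F)"
    using assms(1) unfolding pol_def
    by (auto elim!: sp_mono intro: trans_le_add1)
  then have 2: "\<iota> u * (A - \<iota> z) \<in> sp (?S ?F)" by (rule lin_span.scale)
  have "B - \<iota> u \<in> sp (?S ?F)"
    using assms(2) unfolding pol_def
    by (auto elim!: sp_mono intro: trans_le_add2)
  then have 3: "\<iota> z * (B - \<iota> u) \<in> sp (?S ?F)" by (rule lin_span.scale)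
  have "A * B - \<iota> (z * u) = (A - \<iota> z) * (B - \<iota> u) + \<iota> u * (A - \<iota> z) + \<iota> z * (B - \<iota> u)"
    using iota_comm[of u A] iota_comm[of u "\<iota> z"] by (simp add: algebra_simps)
  then show ?thesis unfolding pol_def using 1 2 3 by (simp add: lin_span.add)
qed

lemma pol_1: "1 \<in> pol (\<lambda>_. 0) 1"
  by (simp add: pol_def lin_span.zero)

lemma pol_linear: "k \<in> {1..n} \<Longrightarrow> X k - \<iota> z \<in> pol (\<lambda>j. if j = k then 1 else 0) (- z)"
proof -
  assume k: "k \<in> {1..n}"
  let ?e = "\<lambda>j. if j = k then 1 else 0 :: nat"
  have "X k = monomial n ?e" using monomial_single[OF k, of 1] by simp
  moreover have "?e \<noteq> (\<lambda>_. 0)" by (auto dest: fun_cong[of _ _ k])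
  ultimately have "X k \<in> sp {monomial n c | c. c \<noteq> (\<lambda>_. 0) \<and> (\<forall>j. c j \<le> ?e j)}"
    by (intro lin_span.base) (use order_refl in blast)
  then show ?thesis by (simp add: pol_def)
qed

lemma pol_prod_list:
  assumes "\<And>i. i \<in> set xs \<Longrightarrow> \<exists>z. f i \<in> pol (D i) z"
  shows "\<exists>z. prod_list (map f xs) \<in> pol (\<lambda>j. \<Sum>i\<leftarrow>xs. D i j) z"
  using assms
proof (induction xs)
  case Nil
  then show ?case using pol_1 by auto
next
  case (Cons i xs)
  then obtain z u where "f i \<in> pol (D i) z" "prod_list (map f xs) \<in> pol (\<lambda>j. \<Sum>i\<leftarrow>xs. D i j) u" by fastforce
  from pol_mult[OF this] show ?case by auto
qed

text \<open>One step of the reduction: \<open>A\<close> is the new polynomial factor,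
  \<open>w\<close> the permutation bringing the variables of block \<open>{m+1..k}\<close> to the
  front, and \<open>y\<close> collects everything from the earlier blocks. As the preimage of
  \<open>{1..b}\<close> under \<open>w\<close> lies in \<open>{m+1..k}\<close>, each nonconstant
  term of \<open>A\<close> leaves a positive exponent in that block after passing
  \<open>Tw T n w\<close>.\<close>

lemma absorb_block:
  assumes A: "A \<in> pol D a" and D: "\<And>j. D j \<le> \<delta>" "\<And>j. j \<notin> {1..b} \<Longrightarrow> D j = 0"
    and w: "w permutes {1..k}" "\<And>j. w j \<in> {1..b} \<Longrightarrow> j \<in> {m+1..k}"
    and m: "m \<le> k" "b \<le> k" "k \<le> n" and y: "y \<in> alg m"
    and e: "\<And>j. j \<notin> {m+1..k} \<Longrightarrow> e j = 0" "\<And>j. e j + \<delta> < r"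
  shows "A * Tw T n w * (y * monomial n e) - (if e = (\<lambda>_. 0) then \<iota> a * (Tw T n w * y) else 0) \<in> N"
proof -
  obtain ws where ws: "set ws \<subseteq> {1..<k}" "reduced_word n w ws" using Tw_word w m by metis
  have kn: "{1..<k} \<subseteq> {1..<n}" using m by auto
  let ?U = "{Tp vs * monomial n c' | vs c'. set vs \<subseteq> {1..<k} \<and>
    (\<exists>j. w j \<in> {1..b} \<and> c' j > 0) \<and> (\<forall>j. c' j \<le> \<delta>) \<and> (\<forall>j. j \<notin> {1..k} \<longrightarrow> c' j = 0)}"
  have "(A - \<iota> a) * Tw T n w \<in> sp ?U"
  proof (rule sp_mult_right)
    show "A - \<iota> a \<in> sp {monomial n c | c. c \<noteq> (\<lambda>_. 0) \<and> (\<forall>j. c j \<le> D j)}" using A by (simp add: pol_def)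
    fix v assume "v \<in> {monomial n c | c. c \<noteq> (\<lambda>_. 0) \<and> (\<forall>j. c j \<le> D j)}"
    then obtain c j where v: "v = monomial n c" and c: "c j \<noteq> 0" "\<And>j. c j \<le> D j" by fastforce
    have "c l = 0" if "l \<notin> {1..b}" for l using c(2)[of l] D(2)[OF that] by simp
    then have "j \<in> {1..b}" "\<And>l. l \<notin> {1..k} \<Longrightarrow> c l = 0" using c m by force+
    moreover have "c l \<le> \<delta>" for l using c(2)[of l] D(1)[of l] by simp
    ultimately show "v * Tw T n w \<in> sp ?U"
      unfolding v Tw_eq[OF ws(2)] using ws c by (intro monomial_Tp_track[of w "[]" ws k j b c]) auto
  qed
  then have "(A - \<iota> a) * Tw T n w * (y * monomial n e)
    \<in> sp {monomial n c * Tw T n w | c w. c \<in> nf n \<and> c \<noteq> (\<lambda>_. 0) \<and> w permutes {1..n}}"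
  proof (rule sp_mult_right)
    fix v assume "v \<in> ?U"
    then obtain vs c j where v: "v = Tp vs * monomial n c" "set vs \<subseteq> {1..<k}"
      and c: "w j \<in> {1..b}" "c j > 0" "\<And>j. c j \<le> \<delta>" "\<And>j. j \<notin> {1..k} \<Longrightarrow> c j = 0" by blast
    \<comment> \<open>The part in the first \<open>m\<close> variables is swallowed by
      \<open>alg m\<close>, whatever its exponents become. The rest commutes with \<open>y\<close>
      and joins \<open>e\<close>, where \<open>e j + \<delta> < r\<close> prevents overflow.\<close>
    let ?lo = "\<lambda>j. if j \<le> m then c j else 0" and ?hi = "\<lambda>j. if j \<le> m then 0 else c j"
    let ?e = "\<lambda>j. ?hi j + e j"
    have lo0: "?lo l = 0" if "l \<notin> {1..m}" for l using that c(4)[of l] by auto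
    have hi0: "?hi l = 0" if "l \<notin> {m+1..n}" for l using that c(4)[of l] m by auto
    have "monomial n c = monomial n ?lo * monomial n ?hi" by (simp add: monomial_mult) (rule monomial_cong, auto)
    then have "v * (y * monomial n e) = Tp vs * (monomial n ?lo * (monomial n ?hi * y) * monomial n e)"
      by (simp add: v mult.assoc)
    also have "monomial n ?hi * y = y * monomial n ?hi" using alg_comm_mono[OF y, of ?hi] hi0 by simp
    also have "monomial n ?lo * (y * monomial n ?hi) * monomial n e = monomial n ?lo * y * monomial n ?e"
      by (simp add: mult.assoc monomial_mult)
    finally have z: "v * (y * monomial n e) = Tp vs * (monomial n ?lo * y * monomial n ?e)" .
    have "monomial n ?lo * y * monomial n ?e \<in> N"
    proof (rule alg_mono_N)
      show "monomial n ?lo * y \<in> alg m" by (rule alg.mult[OF monomial_alg[OF lo0] y])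
      show "m \<le> n" using m by simp
      show "?e l = 0" if "l \<notin> {m+1..n}" for l using hi0[OF that] e(1)[of l] that m by force
      have "j \<in> {m+1..k}" using w(2) c(1) by blast
      then show "?e \<noteq> (\<lambda>_. 0)" using c(2) by (auto dest: fun_cong[of _ _ j])
      show "?e l < r" for l using e(2)[of l] c(3)[of l] by auto
    qed
    then have "v * (y * monomial n e) \<in> N" unfolding z using v kn by (intro Tp_N) auto
    then show "v * (y * monomial n e)
      \<in> sp {monomial n c * Tw T n w | c w. c \<in> nf n \<and> c \<noteq> (\<lambda>_. 0) \<and> w permutes {1..n}}"
      unfolding N_def bspan_def .
  qed
  then have 1: "(A - \<iota> a) * Tw T n w * (y * monomial n e) \<in> N" unfolding N_def bspan_def .
  have s: "A * Tw T n w * (y * monomial n e) = (A - \<iota> a) * Tw T n w * (y * monomial n e) + \<iota> a * (Tw T n w * (y * monomial n e))"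
    by (simp add: left_diff_distrib mult.assoc)
  show ?thesis
  proof (cases "e = (\<lambda>_. 0)")
    case True
    then show ?thesis using 1 s by simp
  next
    case False
    \<comment> \<open>For nonzero \<open>e\<close> even the constant term of \<open>A\<close>
      contributes nothing, since \<open>e\<close> already forces membership in
      \<open>N\<close>.\<close>
    have "y * monomial n e \<in> N"
    proof (rule alg_mono_N[OF y _ _ False])
      show "m \<le> n" using m by simp
      show "e l = 0" if "l \<notin> {m+1..n}" for l using e(1)[of l] that m by force
      show "e l < r" for l using e(2)[of l] by simp
    qed
    moreover have "w permutes {1..n}" using w(1) m permutes_subset[of w "{1..k}" "{1..n}"] by auto
    ultimately have "\<iota> a * (Tw T n w * (y * monomial n e)) \<in> N" by (intro N_scale Tw_N)
    then show ?thesis using 1 s False N_add by simp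
  qed
qed

end

section \<open>Block permutations\<close>

text \<open>The letters act from the right, so \<open>Suc k\<close> is carried upwards step by step,
  and each point it passes drops by one.\<close>

lemma perm_of_word_rev_upt:
  assumes "k < l"
  shows "perm_of_word (rev [Suc k..<l]) j = (if j = Suc k then l else if Suc k < j \<and> j \<le> l then j - 1 else j)"
  using Suc_leI[OF assms]
proof (induction l arbitrary: j rule: dec_induct)
  case (step l)
  then have "rev [Suc k..<Suc l] = l # rev [Suc k..<l]" by simp
  then show ?case using step by (auto simp: stp_def simp del: upt_Suc)
qed auto

text \<open>A power of the cycle on the points above \<open>k\<close> up to \<open>l\<close>; the
  bound on \<open>e\<close> ensures that no point wraps around more than once.\<close>

lemma perm_of_word_replicate:
  assumes "k < l" "e \<le> l - k"
  shows "perm_of_word (concat (replicate e (rev [Suc k..<l]))) j =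
    (if k < j \<and> j \<le> l then (if j \<le> k + e then j + (l - k) - e else j - e) else j)"
  using assms(2)
proof (induction e arbitrary: j)
  case (Suc e)
  let ?y = "perm_of_word (concat (replicate e (rev [Suc k..<l]))) j"
  have IH: "?y = (if k < j \<and> j \<le> l then (if j \<le> k + e then j + (l - k) - e else j - e) else j)"
    using Suc by simp
  have "perm_of_word (concat (replicate (Suc e) (rev [Suc k..<l]))) j
      = (if ?y = Suc k then l else if Suc k < ?y \<and> ?y \<le> l then ?y - 1 else ?y)"
    by (simp only: replicate_Suc concat.simps perm_of_word_append comp_apply perm_of_word_rev_upt[OF assms(1)])
  also have "\<dots> = (if k < j \<and> j \<le> l then (if j \<le> k + Suc e then j + (l - k) - Suc e else j - Suc e) else j)"
  proof -
    consider "\<not> (k < j \<and> j \<le> l)" | "k < j" "j \<le> l" "j \<le> k + e"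
      | "j = Suc (k + e)" "j \<le> l" | "Suc (k + e) < j" "j \<le> l"
      by (cases rule: linorder_cases[of j "Suc (k + e)"]) auto
    then show ?thesis unfolding IH using assms(1) Suc.prems by cases auto
  qed
  finally show ?case .
qed auto

text \<open>The known picture of w_{a,b}: two adjacent intervals of lengths \<open>b\<close> and
  \<open>a\<close> trade places, each keeping its internal order.\<close>

lemma perm_of_word_wword:
  "perm_of_word (wword k a b) j =
    (if k < j \<and> j \<le> k + a + b then (if j \<le> k + b then j + a else j - b) else j)"
proof (cases "a + b = 0")
  \<comment> \<open>The interval is empty here, and the cycle lemma needs
    \<open>k < l\<close>.\<close>
  case True
  then show ?thesis by (auto simp: wword_def)
next
  case False
  then show ?thesis using perm_of_word_replicate[of k "a + b + k" b j]
    by (auto simp: wword_def add.commute add.left_commute)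
qed

lemma set_wword: "set (wword k a b) \<subseteq> {1..<k + a + b}"
  by (auto simp: wword_def)

lemma prod_list_concat: "prod_list (concat xss) = prod_list (map prod_list xss)"
  by (induction xss) auto

text \<open>The exponents are uncurried to functions on pairs, so that finiteness of sets of
  functions with finite support and range applies to them directly.\<close>

lemma finite_Hb_index: "finite (Hb_index p d b)"
proof (rule finite_subset)
  let ?P = "\<Union>t\<in>{1..p}. {w. w permutes {1..b t}}"
  let ?A = "{a. \<forall>tj. (tj \<in> (SIGMA t:{1..p}. {1..b t}) \<longrightarrow> a tj \<in> {..<d}) \<and>
    (tj \<notin> (SIGMA t:{1..p}. {1..b t}) \<longrightarrow> a tj = 0)}"
  let ?X = "{x. \<forall>t. (t \<in> {1..p} \<longrightarrow> x t \<in> ?P) \<and> (t \<notin> {1..p} \<longrightarrow> x t = id)}"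
  have "finite (SIGMA t:{1..p}. {1..b t})" by (rule finite_SigmaI) auto
  then have "finite ?A" by (rule finite_set_of_finite_funs) simp
  moreover have "finite ?P" by (rule finite_UN_I) (auto intro: finite_permutations)
  then have "finite ?X" by (rule finite_set_of_finite_funs[rotated]) simp
  ultimately show "finite (curry ` ?A \<times> ?X)" by (rule finite_cartesian_product[OF finite_imageI])
  show "Hb_index p d b \<subseteq> curry ` ?A \<times> ?X"
  proof
    fix y assume "y \<in> Hb_index p d b"
    then obtain a x where y: "y = (a, x)" and ax: "(a, x) \<in> Hb_index p d b" by (cases y) auto
    have "case_prod a \<in> ?A" using ax by (auto simp: Hb_index_def)
    then have "curry (case_prod a) \<in> curry ` ?A" by (rule imageI)
    then have "a \<in> curry ` ?A" by simp
    moreover have "x \<in> ?X" using ax by (auto simp: Hb_index_def)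
    ultimately show "y \<in> curry ` ?A \<times> ?X" using y by simp
  qed
qed

lemma length_AK_params: "length (AK_params \<epsilon> p d Q) = p * d"
  by (simp add: AK_params_def length_concat comp_def sum_list_triv)

section \<open>Blocks of a composition, their reversal and its inverse\<close>

locale block_data =
  fixes p n :: nat and b :: "nat \<Rightarrow> nat"
  assumes p1: "1 < p" and comp: "comp_pn p n b"
begin

definition M :: "nat \<Rightarrow> nat" where
  "M t = bs b 1 t"

lemma M_0 [simp]: "M 0 = 0"
  and M_Suc [simp]: "M (Suc t) = M t + b (Suc t)"
  and M_p: "M p = n"
  using comp by (simp_all add: M_def bs_def comp_pn_def)

lemma M_mono: "s \<le> t \<Longrightarrow> M s \<le> M t"
  by (induction t rule: dec_induct) auto

lemma M_pred: "1 \<le> t \<Longrightarrow> M t = M (t - 1) + b t"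
  using M_Suc[of "t - 1"] by simp

lemma M_le_n: "t \<le> p \<Longrightarrow> M t \<le> n"
  using M_mono M_p by metis

lemma bs_tail: "t \<le> p \<Longrightarrow> bs b (t + 1) p = n - M t"
proof -
  assume "t \<le> p"
  then have "{1..p} = {1..t} \<union> {t + 1..p}" by auto
  then have "(\<Sum>t\<in>{1..p}. b t) = (\<Sum>t\<in>{1..t}. b t) + (\<Sum>t\<in>{t + 1..p}. b t)"
    by (simp add: sum.union_disjoint)
  then show ?thesis using comp by (simp add: M_def bs_def comp_pn_def)
qed

definition in_block :: "nat \<Rightarrow> nat \<Rightarrow> bool" where
  "in_block s j \<longleftrightarrow> 1 \<le> s \<and> M (s - 1) < j \<and> j \<le> M s"

lemma in_block_ex: "j \<in> {1..M t} \<Longrightarrow> \<exists>s\<le>t. in_block s j"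
proof (induction t)
  case (Suc t)
  show ?case
  proof (cases "j \<le> M t")
    case True
    then show ?thesis using Suc by (meson atLeastAtMost_iff le_SucI)
  next
    case False
    then show ?thesis using Suc.prems by (intro exI[of _ "Suc t"]) (simp add: in_block_def)
  qed
qed simp

lemma in_block_le: "in_block s i \<Longrightarrow> in_block t j \<Longrightarrow> i \<le> j \<Longrightarrow> s \<le> t"
  unfolding in_block_def using M_mono[of t "s - 1"] by force

lemma in_block_gt: "in_block s j \<Longrightarrow> t < s \<Longrightarrow> M t < j"
  unfolding in_block_def using M_mono[of t "s - 1"] by force

lemma in_block_le_M: "in_block s j \<Longrightarrow> s \<le> t \<Longrightarrow> j \<le> M t"
  unfolding in_block_def using M_mono[of s t] by force

text \<open>The permutation next to A_t in v_b: it brings block \<open>t\<close> to the front and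
  shifts the earlier blocks up. \<open>rot 1\<close> is the identity, so \<open>flip\<close> may
  start from 0 although v_b starts at 2.\<close>

definition rot :: "nat \<Rightarrow> nat \<Rightarrow> nat" where
  "rot t = perm_of_word (wword 0 (b t) (M (t - 1)))"

lemma rot_apply:
  "1 \<le> t \<Longrightarrow> rot t j = (if 0 < j \<and> j \<le> M t then (if j \<le> M (t - 1) then j + b t else j - M (t - 1)) else j)"
  using M_pred[of t] by (simp add: rot_def perm_of_word_wword add.commute)

lemma rot_permutes: "1 \<le> t \<Longrightarrow> rot t permutes {1..M t}"
  unfolding rot_def
  by (rule perm_of_word_permutes) (use set_wword[of 0 "b t" "M (t - 1)"] M_pred[of t] in \<open>simp add: add.commute\<close>)

lemma permutes_n: "w permutes {1..M t} \<Longrightarrow> t \<le> p \<Longrightarrow> w permutes {1..n}"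
  using permutes_subset[of w "{1..M t}" "{1..n}"] M_le_n[of t] by auto

text \<open>flip t reverses the order of the first t blocks and keeps the order inside each of them.\<close>

fun flip :: "nat \<Rightarrow> nat \<Rightarrow> nat" where
  "flip 0 = id"
| "flip (Suc t) = rot (Suc t) \<circ> flip t"

lemma flip_permutes: "flip t permutes {1..M t}"
proof (induction t)
  case 0
  show ?case unfolding flip.simps by (rule permutes_id)
next
  case (Suc t)
  have "flip t permutes {1..M (Suc t)}" using Suc permutes_subset[of "flip t" "{1..M t}" "{1..M (Suc t)}"] by auto
  then show ?case unfolding flip.simps using rot_permutes[of "Suc t"] by (intro permutes_compose) auto
qed

lemma flip_apply: "in_block s j \<Longrightarrow> s \<le> t \<Longrightarrow> flip t j = (j - M (s - 1)) + (M t - M s)"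
proof (induction t)
  case (Suc t)
  show ?case
  proof (cases "s = Suc t")
    case True
    then have "flip t j = j" using flip_permutes[of t] in_block_gt[OF Suc.prems(1), of t] by (simp add: permutes_not_in)
    then show ?thesis using Suc.prems True by (simp add: rot_apply in_block_def)
  next
    case False
    then have f: "flip t j = (j - M (s - 1)) + (M t - M s)" and "s \<le> t" using Suc by auto
    have "0 < flip t j" "flip t j \<le> M t"
      using f Suc.prems(1) M_mono[OF \<open>s \<le> t\<close>] by (auto simp: in_block_def)
    then have "flip (Suc t) j = flip t j + b (Suc t)" by (simp add: rot_apply)
    moreover have "M s \<le> M t" using M_mono \<open>s \<le> t\<close> .
    ultimately show ?thesis unfolding M_Suc using f by linarith
  qed
qed (simp add: in_block_def)

text \<open>Truncations of the word of w_b, ordered so that one more factor acts after the previous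
  ones; \<open>unflip (p - 1)\<close> is w_b itself.\<close>

definition unflip :: "nat \<Rightarrow> nat \<Rightarrow> nat" where
  "unflip t = perm_of_word (concat (map (\<lambda>t. wword (M (t - 1)) (b t) (bs b (t + 1) p)) (rev [1..<Suc t])))"

lemma unflip_0 [simp]: "unflip 0 = id"
  by (simp add: unflip_def)

lemma unflip_Suc: "unflip (Suc t) = perm_of_word (wword (M t) (b (Suc t)) (bs b (t + 2) p)) \<circ> unflip t"
  by (simp add: unflip_def)

lemma unflip_permutes: "t \<le> p \<Longrightarrow> unflip t permutes {1..n}"
proof (induction t)
  case 0
  show ?case unfolding unflip_0 by (rule permutes_id)
next
  case (Suc t)
  have "M t + b (Suc t) + bs b (t + 2) p = n"
    using bs_tail[of "Suc t"] M_le_n[of "Suc t"] Suc.prems by simp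
  then have "perm_of_word (wword (M t) (b (Suc t)) (bs b (t + 2) p)) permutes {1..n}"
    using set_wword[of "M t" "b (Suc t)" "bs b (t + 2) p"] by (intro perm_of_word_permutes) simp
  then show ?case unfolding unflip_Suc using Suc by (intro permutes_compose) auto
qed

lemma unflip_Suc_apply:
  assumes "t < p"
  shows "unflip t i \<le> M t \<Longrightarrow> unflip (Suc t) i = unflip t i"
    and "M t < unflip t i \<Longrightarrow> unflip t i \<le> M t + (n - M (Suc t)) \<Longrightarrow> unflip (Suc t) i = unflip t i + b (Suc t)"
    and "M t + (n - M (Suc t)) < unflip t i \<Longrightarrow> unflip t i \<le> n \<Longrightarrow> unflip (Suc t) i = unflip t i - (n - M (Suc t))"
proof -
  have c: "bs b (t + 2) p = n - M (Suc t)" using bs_tail[of "Suc t"] assms by simp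
  have "M (Suc t) \<le> n" using M_le_n[of "Suc t"] assms by simp
  then have "M t + b (Suc t) + (n - M (Suc t)) = n" by simp
  then show "unflip t i \<le> M t \<Longrightarrow> unflip (Suc t) i = unflip t i"
    "M t < unflip t i \<Longrightarrow> unflip t i \<le> M t + (n - M (Suc t)) \<Longrightarrow> unflip (Suc t) i = unflip t i + b (Suc t)"
    "M t + (n - M (Suc t)) < unflip t i \<Longrightarrow> unflip t i \<le> n \<Longrightarrow> unflip (Suc t) i = unflip t i - (n - M (Suc t))"
    unfolding unflip_Suc comp_apply perm_of_word_wword c by auto
qed

text \<open>Invariant: after \<open>t\<close> factors the first \<open>t\<close> blocks are back in
  place, while the others are still in reversed order, shifted up by \<open>M t\<close>. The next
  factor fetches block \<open>Suc t\<close> from the far end.\<close>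

lemma unflip_flip_aux:
  assumes "in_block s j" "s \<le> p" "t < p"
  shows "unflip t (flip p j) = (if s \<le> t then j else flip p j + M t)"
  using assms(3)
proof (induction t)
  case 0
  then show ?case using assms by (simp add: in_block_def)
next
  case (Suc t)
  have t: "t < p" using Suc.prems by simp
  have Mn: "M (Suc t) \<le> n" using M_le_n[of "Suc t"] Suc.prems by simp
  have f: "flip p j = (j - M (s - 1)) + (n - M s)" using flip_apply[OF assms(1,2)] M_p by simp
  have Ms: "M s \<le> n" using M_le_n assms by simp
  have bl: "1 \<le> s" "M (s - 1) < j" "j \<le> M s" using assms(1) by (auto simp: in_block_def)
  have IH: "unflip t (flip p j) = (if s \<le> t then j else flip p j + M t)" using Suc by simp
  note step = unflip_Suc_apply[OF t, of "flip p j"]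
  consider "s \<le> t" | "s = Suc t" | "Suc t < s" by linarith
  then show ?case
  proof cases
    case 1
    then have "j \<le> M t" using in_block_le_M[OF assms(1)] by simp
    then show ?thesis using 1 IH step(1) by simp
  next
    case 2
    then have e: "unflip t (flip p j) = j + (n - M (Suc t))" using IH f bl by simp
    show ?thesis using step(3) 2 bl Mn unfolding e by simp
  next
    case 3
    then have "M (Suc t) \<le> M (s - 1)" using M_mono[of "Suc t" "s - 1"] by simp
    then have le: "flip p j \<le> n - M (Suc t)" using f bl Ms by linarith
    have e: "unflip t (flip p j) = flip p j + M t" using IH 3 by simp
    have "0 < flip p j" using f bl by simp
    then show ?thesis using step(2) le 3 unfolding e by simp
  qed
qed

text \<open>Once \<open>p - 1\<close> blocks are in place, the last one has nowhere else to be,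
  which is why w_b has only \<open>p - 1\<close> factors.\<close>

lemma unflip_flip: "unflip (p - 1) \<circ> flip p = id"
proof
  fix j
  show "(unflip (p - 1) \<circ> flip p) j = id j"
  proof (cases "j \<in> {1..n}")
    case True
    then obtain s where s: "s \<le> p" "in_block s j" using in_block_ex[of j p] M_p by auto
    show ?thesis
    proof (cases "s = p")
      case False
      then have "s \<le> p - 1" "p - 1 < p" using s p1 by auto
      then show ?thesis using unflip_flip_aux[OF s(2,1), of "p - 1"] by simp
    next
      case True
      then show ?thesis using unflip_flip_aux[OF s(2,1), of "p - 1"] s p1 flip_apply[OF s(2,1)]
        by (simp add: in_block_def)
    qed
  next
    case False
    then show ?thesis using flip_permutes[of p] unflip_permutes[of "p - 1"] M_p by (simp add: permutes_not_in)
  qed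
qed

text \<open>The element x'_1 ... x'_t of the Young subgroup, built up block by block.\<close>

fun young :: "(nat \<Rightarrow> nat \<Rightarrow> nat) \<Rightarrow> nat \<Rightarrow> nat \<Rightarrow> nat" where
  "young x 0 = id"
| "young x (Suc t) = young x t \<circ> shiftp (M t) (b (Suc t)) (x (Suc t))"

lemma shiftp_fix: "1 \<le> t \<Longrightarrow> \<not> in_block t j \<Longrightarrow> shiftp (M (t - 1)) (b t) w j = j"
  using M_pred[of t] by (auto simp: in_block_def shiftp_def)

context
  fixes x :: "nat \<Rightarrow> nat \<Rightarrow> nat"
  assumes x: "\<And>t. 1 \<le> t \<Longrightarrow> t \<le> p \<Longrightarrow> x t permutes {1..b t}"
begin

abbreviation "shf t \<equiv> shiftp (M (t - 1)) (b t) (x t)"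

lemma shf_block:
  assumes "1 \<le> t" "t \<le> p" "in_block t j"
  shows "in_block t (shf t j)"
proof -
  have j: "M (t - 1) < j" "j \<le> M (t - 1) + b t" using assms(3) M_pred[OF assms(1)] by (auto simp: in_block_def)
  then have "x t (j - M (t - 1)) \<in> {1..b t}"
    using permutes_in_image[OF x[OF assms(1,2)], of "j - M (t - 1)"] by auto
  then show ?thesis using j assms M_pred[of t] by (auto simp: in_block_def shiftp_def)
qed

lemma shf_permutes:
  assumes "1 \<le> t" "t \<le> p"
  shows "shf t permutes {1..M t}"
proof (rule bij_imp_permutes)
  show "bij_betw (shf t) {1..M t} {1..M t}"
  proof (rule bij_betw_imageI)
    have inj: "inj (x t)" using x[OF assms] permutes_inj by blast
    show i: "inj_on (shf t) {1..M t}"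
    proof (rule inj_onI)
      fix i j assume e: "shf t i = shf t j"
      have "in_block t i \<longleftrightarrow> in_block t j" using e shf_block[OF assms, of i] shf_block[OF assms, of j]
          shiftp_fix[OF assms(1), of i] shiftp_fix[OF assms(1), of j]
        by (cases "in_block t i"; cases "in_block t j") simp_all
      then consider "in_block t i" "in_block t j" | "\<not> in_block t i" "\<not> in_block t j" by blast
      then show "i = j"
      proof cases
        case 1
        then have "x t (i - M (t - 1)) = x t (j - M (t - 1))"
          using e M_pred[OF assms(1)] by (auto simp: in_block_def shiftp_def)
        then have "i - M (t - 1) = j - M (t - 1)" by (rule injD[OF inj])
        then show ?thesis using 1 by (auto simp: in_block_def)
      next
        case 2
        then show ?thesis using e shiftp_fix[OF assms(1), of i] shiftp_fix[OF assms(1), of j] by simp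
      qed
    qed
    have "shf t ` {1..M t} \<subseteq> {1..M t}"
    proof clarify
      fix j assume "j \<in> {1..M t}"
      then show "shf t j \<in> {1..M t}"
        using shf_block[OF assms, of j] shiftp_fix[OF assms(1), of j] by (cases "in_block t j") (auto simp: in_block_def)
    qed
    then show "shf t ` {1..M t} = {1..M t}" using i by (intro endo_inj_surj) auto
  qed
  fix j assume "j \<notin> {1..M t}"
  then show "shf t j = j" using shiftp_fix[OF assms(1), of j] by (auto simp: in_block_def)
qed

lemma young_permutes: "t \<le> p \<Longrightarrow> young x t permutes {1..M t}"
proof (induction t)
  case 0
  show ?case unfolding young.simps by (rule permutes_id)
next
  case (Suc t)
  then have "young x t permutes {1..M (Suc t)}" using permutes_subset[of "young x t" "{1..M t}" "{1..M (Suc t)}"] by auto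
  then show ?case unfolding young.simps using shf_permutes[of "Suc t"] Suc.prems by (intro permutes_compose) auto
qed

lemma young_fix: "t \<le> p \<Longrightarrow> M t < j \<Longrightarrow> young x t j = j"
  using permutes_not_in[OF young_permutes] by simp

lemma young_apply: "t \<le> p \<Longrightarrow> in_block s j \<Longrightarrow> s \<le> t \<Longrightarrow> young x t j = shf s j"
proof (induction t)
  case 0
  then show ?case by (simp add: in_block_def)
next
  case (Suc t)
  show ?case
  proof (cases "s = Suc t")
    case True
    then have "in_block s (shf s j)" using shf_block[of s j] Suc.prems by (auto simp: in_block_def)
    then have "M t < shf s j" using True by (simp add: in_block_def)
    then show ?thesis using True young_fix Suc.prems by simp
  next
    case False
    then have "\<not> in_block (Suc t) j" using Suc.prems in_block_le[of "Suc t" j s j] by auto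
    then have "shf (Suc t) j = j" by (intro shiftp_fix) auto
    then show ?thesis using False Suc by simp
  qed
qed

lemma young_block: "in_block s j \<Longrightarrow> s \<le> p \<Longrightarrow> in_block s (young x p j)"
  using young_apply[of p s j] shf_block[of s j] by (simp add: in_block_def)

lemma young_eq_id:
  assumes "young x p = id" "1 \<le> t" "t \<le> p"
  shows "x t = id"
proof
  fix i
  show "x t i = id i"
  proof (cases "i \<in> {1..b t}")
    case True
    then have "in_block t (M (t - 1) + i)" using M_pred[OF assms(2)] assms by (auto simp: in_block_def)
    then have "shf t (M (t - 1) + i) = M (t - 1) + i"
      using young_apply[of p t] assms by simp
    then show ?thesis using True by (simp add: shiftp_def)
  next
    case False
    then show ?thesis using x[OF assms(2,3)] by (simp add: permutes_not_in)
  qed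
qed

end

end

section \<open>The trace formula\<close>

locale block_algebra =
  ariki_koike \<iota> q "AK_params \<epsilon> p d Q" n T + block_data p n b
  for \<iota> :: "'r::comm_ring_1 \<Rightarrow> 'a::ring_1" and q \<epsilon> :: 'r and p d n :: nat and Q :: "nat \<Rightarrow> 'r"
    and T :: "nat \<Rightarrow> 'a" and b :: "nat \<Rightarrow> nat" +
  assumes d1: "1 \<le> d"
begin

section \<open>Degrees of the factors of v_b\<close>

lemma r_eq: "r = p * d"
  by (rule length_AK_params)

abbreviation "Lsk s k \<equiv> Ls \<iota> q T \<epsilon> d Q s k"

lemma Ls_pol:
  assumes "k \<in> {1..n}"
  shows "\<exists>z. Lsk s k \<in> pol (\<lambda>j. if j = k then d else 0) z"
proof -
  have "\<exists>z. Lsk s k \<in> pol (\<lambda>j. \<Sum>i\<leftarrow>[1..<d + 1]. if j = k then 1 else 0) z"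
    unfolding Ls_def by (rule pol_prod_list) (use pol_linear[OF assms] in blast)
  moreover have "(\<lambda>j. \<Sum>i\<leftarrow>[1..<d + 1]. if j = k then 1 else 0) = (\<lambda>j. if j = k then d else 0)"
    by (auto simp: sum_list_triv fun_eq_iff)
  ultimately show ?thesis by metis
qed

text \<open>Each variable receives one factor \<open>Ls\<close> for every entry of
  \<open>Iset p i j\<close>, and each such factor has degree \<open>d\<close>.\<close>

lemma Lij_pol:
  assumes "m \<le> n"
  shows "\<exists>z. Lij \<iota> q T \<epsilon> p d Q i j 1 m \<in> pol (\<lambda>l. if l \<in> {1..m} then d * length (Iset p i j) else 0) z"
proof -
  let ?D = "\<lambda>k l. \<Sum>s\<leftarrow>Iset p i j. if l = k then d else 0"
  have "\<exists>z. Lij \<iota> q T \<epsilon> p d Q i j 1 m \<in> pol (\<lambda>l. \<Sum>k\<leftarrow>[1..<m + 1]. ?D k l) z"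
    unfolding Lij_def prod_list_concat map_map comp_def
  proof (rule pol_prod_list)
    fix k assume "k \<in> set [1..<m + 1]"
    then have "k \<in> {1..n}" using assms by auto
    then show "\<exists>z. prod_list (map (\<lambda>s. Lsk s k) (Iset p i j)) \<in> pol (?D k) z"
      by (intro pol_prod_list Ls_pol)
  qed
  moreover have "(\<Sum>k\<leftarrow>[1..<m + 1]. ?D k l) = (if l \<in> {1..m} then d * length (Iset p i j) else 0)" for l
  proof -
    have "?D k l = (if l = k then d * length (Iset p i j) else 0)" for k
      by (simp add: sum_list_triv)
    then have "(\<Sum>k\<leftarrow>[1..<m + 1]. ?D k l) = (\<Sum>k\<leftarrow>[1..<m + 1]. if l = k then d * length (Iset p i j) else 0)"
      by simp
    also have "\<dots> = (\<Sum>k\<in>{1..<m + 1}. if l = k then d * length (Iset p i j) else 0)"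
      by (subst sum_list_distinct_conv_sum_set) auto
    also have "\<dots> = (if l \<in> {1..m} then d * length (Iset p i j) else 0)"
      by (auto simp: sum.delta)
    finally show ?thesis .
  qed
  ultimately show ?thesis by simp
qed

lemma pol_alg:
  assumes "A \<in> pol D z" "\<And>j. j \<notin> {1..m} \<Longrightarrow> D j = 0"
  shows "A \<in> alg m"
proof -
  have "A - \<iota> z \<in> sp {monomial n c | c. c \<noteq> (\<lambda>_. 0) \<and> (\<forall>j. c j \<le> D j)}"
    using assms(1) by (simp add: pol_def)
  then have "A - \<iota> z \<in> alg m"
  proof (induction rule: lin_span.induct)
    case zero
    then show ?case using alg.iota[of 0] by simp
  next
    case (base x)
    then obtain c where c: "x = monomial n c" "\<forall>j. c j \<le> D j" by blast
    have "c j = 0" if "j \<notin> {1..m}" for j using c(2) assms(2)[OF that] by (metis le_zero_eq)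
    then show ?case unfolding c(1) by (rule monomial_alg)
  qed (auto intro: alg.intros)
  then have "(A - \<iota> z) + \<iota> z \<in> alg m" by (intro alg.add alg.iota)
  then show ?thesis by simp
qed

section \<open>Reduction of v_b modulo N\<close>

abbreviation "A t \<equiv> Lij \<iota> q T \<epsilon> p d Q 1 (t - 1) 1 (b t)"

text \<open>Partial products that grow on the left, so that each new \<open>A t\<close> meets on its
  right only an element of the subalgebra for the earlier blocks.\<close>

definition F :: "nat \<Rightarrow> 'a" where
  "F t = prod_list (map (\<lambda>t. A t * Tw T n (rot t)) (rev [2..<t + 1]))"

lemma F_1: "F 1 = 1"
  and F_Suc: "1 \<le> t \<Longrightarrow> F (Suc t) = A (Suc t) * Tw T n (rot (Suc t)) * F t"
  by (simp_all add: F_def numeral_2_eq_2)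

lemma b_le_M: "b t \<le> M t" if "1 \<le> t"
  using M_pred[OF that] by simp

lemma A_pol:
  assumes "1 \<le> t" "Suc t \<le> p"
  shows "\<exists>z. A (Suc t) \<in> pol (\<lambda>l. if l \<in> {1..b (Suc t)} then d * t else 0) z"
proof -
  have n: "b (Suc t) \<le> n" using b_le_M[of "Suc t"] M_le_n[of "Suc t"] assms by simp
  have "length (Iset p 1 t) = t" using assms by (simp add: Iset_def)
  then show ?thesis using Lij_pol[OF n, of 1 t] by (simp only: diff_Suc_1)
qed

lemma F_alg: "1 \<le> t \<Longrightarrow> t \<le> p \<Longrightarrow> F t \<in> alg (M t)"
proof (induction t rule: dec_induct)
  case base
  show ?case unfolding F_1 by (rule alg_1)
next
  case (step t)
  then have t: "1 \<le> t" "Suc t \<le> p" by auto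
  obtain z where z: "A (Suc t) \<in> pol (\<lambda>l. if l \<in> {1..b (Suc t)} then d * t else 0) z"
    using A_pol[OF t] by blast
  have "A (Suc t) \<in> alg (M (Suc t))" by (rule pol_alg[OF z]) auto
  moreover have "Tw T n (rot (Suc t)) \<in> alg (M (Suc t))"
    by (rule Tw_alg[OF rot_permutes M_le_n[OF t(2)]]) simp
  moreover have "F t \<in> alg (M (Suc t))" using step.IH t alg_mono[of "F t" "M t" "M (Suc t)"] by simp
  ultimately show ?case unfolding F_Suc[OF t(1)] by (intro alg.mult)
qed

text \<open>Inversions of \<open>flip t\<close> have both values at most \<open>M t\<close>, and
  there \<open>rot (Suc t)\<close> is a translation of the positive values, so it undoes none of
  them.\<close>

lemma Tw_rot_flip: "t < p \<Longrightarrow> Tw T n (rot (Suc t)) * Tw T n (flip t) = Tw T n (flip (Suc t))"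
  unfolding flip.simps
proof (rule Tw_comp)
  assume t: "t < p"
  show "rot (Suc t) permutes {1..n}" using permutes_n[OF rot_permutes] t by simp
  show "flip t permutes {1..n}" using permutes_n[OF flip_permutes] t by simp
  fix i j assume ij: "i < j" "flip t j < flip t i"
  have fp: "flip t permutes {1..M t}" by (rule flip_permutes)
  have "flip t i \<le> M t"
  proof (rule ccontr)
    assume c: "\<not> flip t i \<le> M t"
    then have "i \<notin> {1..M t}" using permutes_in_image[OF fp, of i] by auto
    then have "flip t i = i" using permutes_not_in[OF fp] by blast
    then have "flip t j = j" using permutes_not_in[OF fp] c ij by simp
    then show False using ij \<open>flip t i = i\<close> by simp
  qed
  then show "rot (Suc t) (flip t j) < rot (Suc t) (flip t i)"
    using ij by (simp add: rot_apply)
qed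

text \<open>The bound says that in block s there is room for the degree d (s - 1) that A s contributes.\<close>

lemma F_mono:
  assumes "1 \<le> t" "t \<le> p"
  shows "\<exists>K. \<forall>e. (\<forall>j. j \<notin> {1..M t} \<longrightarrow> e j = 0) \<longrightarrow>
    (\<forall>s j. in_block s j \<longrightarrow> s \<le> t \<longrightarrow> e j + d * (s - 1) < r) \<longrightarrow>
    F t * monomial n e - (if e = (\<lambda>_. 0) then \<iota> K * Tw T n (flip t) else 0) \<in> N"
  using assms
proof (induction t rule: dec_induct)
  case base
  show ?case
  \<comment> \<open>The product is empty and \<open>flip 1\<close> the identity; it remains to see
    that nonconstant monomials lie in \<open>N\<close>, which is \<open>alg_mono_N\<close> with
    \<open>m = 0\<close>.\<close>
  proof (intro exI[of _ 1] allI impI)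
    fix e assume e: "\<forall>j. j \<notin> {1..M 1} \<longrightarrow> e j = 0"
      "\<forall>s j. in_block s j \<longrightarrow> s \<le> 1 \<longrightarrow> e j + d * (s - 1) < r"
    have "rot 1 = id" by (rule ext) (simp add: rot_apply)
    then have f: "flip 1 = id" by simp
    show "F 1 * monomial n e - (if e = (\<lambda>_. 0) then \<iota> 1 * Tw T n (flip 1) else 0) \<in> N"
    proof (cases "e = (\<lambda>_. 0)")
      case True
      then show ?thesis unfolding F_1 f True by (simp add: N_zero del: id_apply)
    next
      case False
      have "1 * monomial n e \<in> N"
      proof (rule alg_mono_N[of 1 0])
        show "1 \<in> alg 0" by (rule alg_1)
        show "e \<noteq> (\<lambda>_. 0)" by fact
        show "e j = 0" if "j \<notin> {0 + 1..n}" for j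
          using e(1) M_le_n[of 1] p1 that by (cases "j \<in> {1..M 1}") auto
        show "e j < r" for j
        proof (cases "j \<in> {1..M 1}")
          case True
          then have "in_block 1 j" by (auto simp: in_block_def)
          then show ?thesis using e(2) by force
        next
          case False
          then show ?thesis using e(1) r_pos by simp
        qed
      qed simp
      then show ?thesis using False unfolding F_1 by simp
    qed
  qed
next
  case (step t)
  then have t: "1 \<le> t" "Suc t \<le> p" by auto
  obtain K where K: "\<And>e. (\<forall>j. j \<notin> {1..M t} \<longrightarrow> e j = 0) \<Longrightarrow>
    (\<forall>s j. in_block s j \<longrightarrow> s \<le> t \<longrightarrow> e j + d * (s - 1) < r) \<Longrightarrow>
    F t * monomial n e - (if e = (\<lambda>_. 0) then \<iota> K * Tw T n (flip t) else 0) \<in> N"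
    using step.IH t by auto
  let ?D = "\<lambda>l. if l \<in> {1..b (Suc t)} then d * t else 0"
  let ?w = "rot (Suc t)"
  obtain a where a: "A (Suc t) \<in> pol ?D a"
    using A_pol[OF t] by blast
  have w: "?w permutes {1..M (Suc t)}" by (rule rot_permutes) simp
  show ?case
  \<comment> \<open>The scalar is the product of the constant term of the new factor with the
    earlier scalar. It is fixed before \<open>e\<close>, and this uniformity is what the final
    comparison needs.\<close>
  proof (intro exI[of _ "a * K"] allI impI)
    fix e assume e: "\<forall>j. j \<notin> {1..M (Suc t)} \<longrightarrow> e j = 0"
      "\<forall>s j. in_block s j \<longrightarrow> s \<le> Suc t \<longrightarrow> e j + d * (s - 1) < r"
    \<comment> \<open>The earlier blocks stay with \<open>F t\<close> and fall under the induction
      hypothesis; block \<open>Suc t\<close> is the business of \<open>absorb_block\<close>.\<close>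
    let ?lo = "\<lambda>j. if j \<le> M t then e j else 0" and ?hi = "\<lambda>j. if j \<le> M t then 0 else e j"
    have e0: "e 0 = 0" using e(1) by simp
    have lo0: "?lo j = 0" if "j \<notin> {1..M t}" for j using that e0 by (cases j) auto
    have split: "monomial n e = monomial n ?lo * monomial n ?hi" by (simp add: monomial_mult) (rule monomial_cong, auto)
    have y: "F t * monomial n ?lo \<in> alg (M t)"
      using F_alg[of t] t lo0 by (intro alg.mult monomial_alg) auto
    have 1: "A (Suc t) * Tw T n ?w * (F t * monomial n ?lo * monomial n ?hi)
      - (if ?hi = (\<lambda>_. 0) then \<iota> a * (Tw T n ?w * (F t * monomial n ?lo)) else 0) \<in> N"
    proof (rule absorb_block[OF a _ _ w _ _ _ _ y, where \<delta> = "d * t"])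
      show "?D j \<le> d * t" "j \<notin> {1..b (Suc t)} \<Longrightarrow> ?D j = 0" for j by auto
      show "M t \<le> M (Suc t)" "b (Suc t) \<le> M (Suc t)" by simp_all
      show "M (Suc t) \<le> n" by (rule M_le_n[OF t(2)])
      show "j \<in> {M t + 1..M (Suc t)}" if "?w j \<in> {1..b (Suc t)}" for j
        using that rot_apply[of "Suc t" j] by (auto split: if_splits)
      show "?hi j = 0" if "j \<notin> {M t + 1..M (Suc t)}" for j using that e(1) by auto
      show "?hi j + d * t < r" for j
      proof (cases "j \<in> {M t + 1..M (Suc t)}")
        case True
        then have "in_block (Suc t) j" by (auto simp: in_block_def)
        then have "e j + d * t < r" using e(2) by force
        then show ?thesis using True by simp
      next
        case False
        \<comment> \<open>Outside the block \<open>?hi\<close> vanishes, and \<open>t < p\<close>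
          alone gives the bound.\<close>
        moreover have "d * t < r" using t d1 unfolding r_eq by (simp add: mult.commute)
        ultimately show ?thesis using e(1) by auto
      qed
    qed
    have "F t * monomial n ?lo - (if ?lo = (\<lambda>_. 0) then \<iota> K * Tw T n (flip t) else 0) \<in> N"
    proof (rule K)
      show "\<forall>j. j \<notin> {1..M t} \<longrightarrow> ?lo j = 0" using lo0 by blast
      show "\<forall>s j. in_block s j \<longrightarrow> s \<le> t \<longrightarrow> ?lo j + d * (s - 1) < r"
        using e(2) in_block_le_M by fastforce
    qed
    moreover have "?w permutes {1..n}" using permutes_n[OF w t(2)] .
    ultimately have "\<iota> a * (Tw T n ?w * (F t * monomial n ?lo - (if ?lo = (\<lambda>_. 0) then \<iota> K * Tw T n (flip t) else 0))) \<in> N"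
      by (intro N_scale Tw_N)
    moreover have "\<iota> a * (Tw T n ?w * (\<iota> K * Tw T n (flip t))) = \<iota> (a * K) * Tw T n (flip (Suc t))"
    proof -
      have "Tw T n ?w * (\<iota> K * Tw T n (flip t)) = \<iota> K * Tw T n (flip (Suc t))"
        using Tw_rot_flip[of t] t by (simp only: iota_left_comm Suc_le_eq)
      then show ?thesis by (simp only: iota_simps mult.assoc)
    qed
    ultimately have 2: "\<iota> a * (Tw T n ?w * (F t * monomial n ?lo))
      - (if ?lo = (\<lambda>_. 0) then \<iota> (a * K) * Tw T n (flip (Suc t)) else 0) \<in> N"
      by (cases "?lo = (\<lambda>_. 0)") (simp_all only: simp_thms right_diff_distrib if_True if_False diff_zero)
    have e_iff: "e = (\<lambda>_. 0) \<longleftrightarrow> ?lo = (\<lambda>_. 0) \<and> ?hi = (\<lambda>_. 0)"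
    proof
      assume h: "?lo = (\<lambda>_. 0) \<and> ?hi = (\<lambda>_. 0)"
      show "e = (\<lambda>_. 0)"
      proof
        fix j show "e j = 0"
          using fun_cong[OF conjunct1[OF h], of j] fun_cong[OF conjunct2[OF h], of j]
          by (cases "j \<le> M t") auto
      qed
    qed auto
    have F: "F (Suc t) * monomial n e = A (Suc t) * Tw T n ?w * (F t * monomial n ?lo * monomial n ?hi)"
      unfolding F_Suc[OF t(1)] split by (simp only: mult.assoc)
    show "F (Suc t) * monomial n e - (if e = (\<lambda>_. 0) then \<iota> (a * K) * Tw T n (flip (Suc t)) else 0) \<in> N"
    proof (cases "?hi = (\<lambda>_. 0)")
      case False
      then show ?thesis using 1 by (simp only: F e_iff simp_thms if_False)
    next
      case True
      then show ?thesis using N_add[OF 1 2]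
        by (simp only: F e_iff simp_thms if_True add_diff_eq diff_add_cancel)
    qed
  qed
qed

definition B :: 'a where
  "B = prod_list (map (\<lambda>t. Lij \<iota> q T \<epsilon> p d Q t t 1 (M (t - 1))) [2..<p + 1])"

lemma vb_eq: "vb \<iota> q T \<epsilon> p d Q n b = F p * B"
  by (simp add: vb_def F_def B_def rot_def M_def)

text \<open>The factor of index \<open>t\<close> in \<open>B\<close> involves only variables of
  blocks before \<open>t\<close>. A variable of block \<open>s\<close> is thus met by the factors
  \<open>t = s + 1\<close>, ..., \<open>p\<close> only, each of degree \<open>d\<close>.\<close>

lemma B_pol:
  "\<exists>D z. B \<in> pol D z \<and> (\<forall>j. j \<notin> {1..n} \<longrightarrow> D j = 0) \<and>
    (\<forall>s j. in_block s j \<longrightarrow> s \<le> p \<longrightarrow> D j \<le> d * (p - s))"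
proof -
  let ?D = "\<lambda>t l. if l \<in> {1..M (t - 1)} then d else 0"
  have "\<exists>z. B \<in> pol (\<lambda>l. \<Sum>t\<leftarrow>[2..<p + 1]. ?D t l) z"
    unfolding B_def
  proof (rule pol_prod_list)
    fix t assume "t \<in> set [2..<p + 1]"
    then have "M (t - 1) \<le> n" by (intro M_le_n) auto
    moreover have "length (Iset p t t) = 1" by (simp add: Iset_def)
    ultimately show "\<exists>z. Lij \<iota> q T \<epsilon> p d Q t t 1 (M (t - 1)) \<in> pol (?D t) z"
      using Lij_pol[of "M (t - 1)" t t] by (simp only: mult_1_right)
  qed
  then obtain z where z: "B \<in> pol (\<lambda>l. \<Sum>t\<leftarrow>[2..<p + 1]. ?D t l) z" by blast
  have eq: "(\<Sum>t\<leftarrow>[2..<p + 1]. ?D t l) = (\<Sum>t\<in>{2..p}. ?D t l)" for l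
    by (subst sum_list_distinct_conv_sum_set) (auto intro!: sum.cong)
  have "(\<Sum>t\<in>{2..p}. ?D t l) = 0" if "l \<notin> {1..n}" for l
  proof (rule sum.neutral, rule ballI)
    fix t assume "t \<in> {2..p}"
    then have "M (t - 1) \<le> n" by (intro M_le_n) auto
    then show "?D t l = 0" using that by auto
  qed
  moreover have "(\<Sum>t\<in>{2..p}. ?D t j) \<le> d * (p - s)" if "in_block s j" "s \<le> p" for s j
  proof -
    have z0: "?D t j = 0" if "t \<in> {2..p} - {s + 1..p}" for t
    proof -
      have "t - 1 < s" using that by auto
      then have "M (t - 1) < j" using in_block_gt \<open>in_block s j\<close> by blast
      then show ?thesis by simp
    qed
    have "(\<Sum>t\<in>{2..p}. ?D t j) = (\<Sum>t\<in>{s + 1..p}. ?D t j)"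
    proof (rule sum.mono_neutral_right)
      show "{s + 1..p} \<subseteq> {2..p}" using that by (auto simp: in_block_def)
      show "\<forall>t\<in>{2..p} - {s + 1..p}. ?D t j = 0" by (intro ballI z0)
    qed simp
    also have "\<dots> \<le> (\<Sum>t\<in>{s + 1..p}. d)" by (rule sum_mono) simp
    finally show ?thesis by (simp add: mult.commute)
  qed
  ultimately show ?thesis using z unfolding eq by (intro exI[of _ "\<lambda>l. \<Sum>t\<in>{2..p}. ?D t l"] exI[of _ z]) blast
qed

lemma vb_mono:
  "\<exists>K. \<forall>c. (\<forall>j. j \<notin> {1..n} \<longrightarrow> c j = 0) \<longrightarrow> (\<forall>j. c j < d) \<longrightarrow>
    F p * B * monomial n c - (if c = (\<lambda>_. 0) then \<iota> K * Tw T n (flip p) else 0) \<in> N"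
proof -
  obtain D z where z: "B \<in> pol D z" and D: "\<And>j. j \<notin> {1..n} \<Longrightarrow> D j = 0"
    "\<And>s j. in_block s j \<Longrightarrow> s \<le> p \<Longrightarrow> D j \<le> d * (p - s)"
    using B_pol by blast
  obtain K where K: "\<And>e. (\<forall>j. j \<notin> {1..M p} \<longrightarrow> e j = 0) \<Longrightarrow>
    (\<forall>s j. in_block s j \<longrightarrow> s \<le> p \<longrightarrow> e j + d * (s - 1) < r) \<Longrightarrow>
    F p * monomial n e - (if e = (\<lambda>_. 0) then \<iota> K * Tw T n (flip p) else 0) \<in> N"
    using F_mono[of p] p1 by auto
  have K': "F p * monomial n (\<lambda>j. u j + c j) - (if (\<lambda>j. u j + c j) = (\<lambda>_. 0) then \<iota> K * Tw T n (flip p) else 0) \<in> N"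
    if c: "\<forall>j. j \<notin> {1..n} \<longrightarrow> c j = 0" "\<forall>j. c j < d" and u: "\<And>j. u j \<le> D j" for u c
  proof (rule K)
    show "\<forall>j. j \<notin> {1..M p} \<longrightarrow> u j + c j = 0"
      using c(1) u D(1) M_p by (metis add_0 le_zero_eq)
    show "\<forall>s j. in_block s j \<longrightarrow> s \<le> p \<longrightarrow> u j + c j + d * (s - 1) < r"
    proof (intro allI impI)
      fix s j assume s: "in_block s j" "s \<le> p"
      \<comment> \<open>The exponent budget of block \<open>s\<close>: shares for \<open>B\<close>,
        for the monomial of h, whose exponents are strictly below \<open>d\<close>, and for
        A_s.\<close>
      have "p * d = d * (p - s) + d + d * (s - 1)"
      proof -
        have "p = (p - s) + 1 + (s - 1)" using s by (simp add: in_block_def)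
        then have "d * p = d * ((p - s) + 1 + (s - 1))" by simp
        then show ?thesis by (simp add: distrib_left mult.commute)
      qed
      moreover have "u j \<le> d * (p - s)" using u[of j] D(2)[OF s] by simp
      ultimately show "u j + c j + d * (s - 1) < r" using c(2) unfolding r_eq
        by (metis add_le_less_mono add_less_mono1)
    qed
  qed
  show ?thesis
  \<comment> \<open>A nonconstant monomial of \<open>B\<close> times the monomial of
    \<open>c\<close> is again nonconstant and is killed, so only the constant term \<open>z\<close>
    of \<open>B\<close> enters the scalar.\<close>
  proof (intro exI[of _ "z * K"] allI impI)
    fix c assume c: "\<forall>j. j \<notin> {1..n} \<longrightarrow> c j = 0" "\<forall>j. c j < d"
    have "B - \<iota> z \<in> sp {monomial n u | u. u \<noteq> (\<lambda>_. 0) \<and> (\<forall>j. u j \<le> D j)}"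
      using z by (simp add: pol_def)
    then have "F p * ((B - \<iota> z) * monomial n c) \<in> N"
    proof (induction rule: lin_span.induct)
      case (base x)
      then obtain u where x: "x = monomial n u" "u \<noteq> (\<lambda>_. 0)" "\<And>j. u j \<le> D j" by blast
      obtain j where "u j \<noteq> 0" using x(2) by auto
      then have "(\<lambda>j. u j + c j) \<noteq> (\<lambda>_. 0)" by (auto dest: fun_cong[of _ _ j])
      moreover have "x * monomial n c = monomial n (\<lambda>j. u j + c j)" by (simp add: x monomial_mult)
      ultimately show ?case using K'[OF c x(3)] by simp
    next
      case (scale x a)
      then show ?case by (simp only: mult.assoc iota_left_comm N_scale)
    qed (simp_all add: N_zero N_add distrib_left distrib_right)
    moreover have "\<iota> z * (F p * monomial n c - (if c = (\<lambda>_. 0) then \<iota> K * Tw T n (flip p) else 0)) \<in> N"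
      by (rule N_scale) (use K'[OF c, of "\<lambda>_. 0"] in \<open>simp only: add_0_left le0 simp_thms\<close>)
    moreover have "F p * B * monomial n c - (if c = (\<lambda>_. 0) then \<iota> (z * K) * Tw T n (flip p) else 0)
      = F p * ((B - \<iota> z) * monomial n c)
        + \<iota> z * (F p * monomial n c - (if c = (\<lambda>_. 0) then \<iota> K * Tw T n (flip p) else 0))"
      by (simp add: left_diff_distrib right_diff_distrib mult.assoc iota_left_comm[of "F p"])
    ultimately show "F p * B * monomial n c - (if c = (\<lambda>_. 0) then \<iota> (z * K) * Tw T n (flip p) else 0) \<in> N"
      by (simp only: N_add)
  qed
qed

lemma Tb_eq: "Tb T p n b = Tw T n (unflip (p - 1))"
  using p1 by (simp add: Tb_def unflip_def M_def)

lemma Tr_vb_mono_Tw: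
  "\<exists>K. \<forall>c w. (\<forall>j. j \<notin> {1..n} \<longrightarrow> c j = 0) \<longrightarrow> (\<forall>j. c j < d) \<longrightarrow> w permutes {1..n} \<longrightarrow>
    Tr (F p * B * (monomial n c * Tw T n w) * Tb T p n b)
      = (if c = (\<lambda>_. 0) then K * Tr (Tw T n (flip p) * Tw T n w * Tb T p n b) else 0)"
proof -
  obtain K where K: "\<forall>c. (\<forall>j. j \<notin> {1..n} \<longrightarrow> c j = 0) \<longrightarrow> (\<forall>j. c j < d) \<longrightarrow>
    F p * B * monomial n c - (if c = (\<lambda>_. 0) then \<iota> K * Tw T n (flip p) else 0) \<in> N"
    using vb_mono by blast
  show ?thesis
  proof (intro exI[of _ K] allI impI)
    fix c w assume c: "\<forall>j. j \<notin> {1..n} \<longrightarrow> c j = 0" "\<forall>j. c j < d" and w: "w permutes {1..n}"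
    let ?z = "if c = (\<lambda>_. 0) then \<iota> K * Tw T n (flip p) else 0"
    have "unflip (p - 1) permutes {1..n}" using unflip_permutes by simp
    moreover have "F p * B * monomial n c - ?z \<in> N" by (rule K[rule_format]) (use c in auto)
    ultimately have "(F p * B * monomial n c - ?z) * Tw T n w * Tb T p n b \<in> N"
      unfolding Tb_eq using w by (intro N_Tw)
    then have "Tr ((F p * B * monomial n c - ?z) * Tw T n w * Tb T p n b) = 0" by (rule Tr_N)
    moreover have "F p * B * (monomial n c * Tw T n w) * Tb T p n b
      = (F p * B * monomial n c - ?z) * Tw T n w * Tb T p n b + ?z * Tw T n w * Tb T p n b"
      by (simp only: left_diff_distrib mult.assoc diff_add_cancel)
    ultimately have "Tr (F p * B * (monomial n c * Tw T n w) * Tb T p n b) = Tr (?z * Tw T n w * Tb T p n b)"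
      by (simp only: Tr_add add_0)
    then show "Tr (F p * B * (monomial n c * Tw T n w) * Tb T p n b)
      = (if c = (\<lambda>_. 0) then K * Tr (Tw T n (flip p) * Tw T n w * Tb T p n b) else 0)"
      by (cases "c = (\<lambda>_. 0)") (simp_all only: simp_thms if_True if_False mult.assoc Tr_scale mult_zero_left Tr_0)
  qed
qed

section \<open>Images of basis elements under Theta\<close>

text \<open>Several values of \<open>M\<close> may coincide when blocks are empty; the least index
  picks the block that really contains \<open>j\<close>.\<close>

definition blk :: "nat \<Rightarrow> nat" where
  "blk j = (LEAST t. j \<le> M t)"

lemma blk_eq: "in_block s j \<Longrightarrow> blk j = s"
  unfolding blk_def
proof (rule Least_equality)
  assume s: "in_block s j"
  then show "j \<le> M s" by (simp add: in_block_def)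
  fix t assume "j \<le> M t"
  then show "s \<le> t" using in_block_gt[OF s, of t] by linarith
qed

text \<open>Flattens the exponents of the tensor factors into one vector on
  \<open>{1..n}\<close>.\<close>

definition expo :: "(nat \<Rightarrow> nat \<Rightarrow> nat) \<Rightarrow> nat \<Rightarrow> nat" where
  "expo a j = (if j \<in> {1..n} then a (blk j) (j - M (blk j - 1)) else 0)"

lemma expo_apply:
  assumes "1 \<le> t" "t \<le> p" "j \<in> {1..b t}"
  shows "expo a (M (t - 1) + j) = a t j"
proof -
  have "in_block t (M (t - 1) + j)" using M_pred[OF assms(1)] assms by (auto simp: in_block_def)
  moreover from this have "M (t - 1) + j \<le> n" using M_le_n[OF assms(2)] by (simp add: in_block_def)
  ultimately show ?thesis using assms(3) by (simp add: expo_def blk_eq)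
qed

lemma expo_eq_0:
  assumes "(a, x) \<in> Hb_index p d b" "expo a = (\<lambda>_. 0)"
  shows "a = (\<lambda>t j. 0)"
proof (intro ext)
  fix t j
  show "a t j = 0"
  proof (cases "1 \<le> t \<and> t \<le> p \<and> j \<in> {1..b t}")
    case True
    then show ?thesis using expo_apply[of t j a] assms(2) by simp
  next
    case False
    then show ?thesis using assms(1) by (auto simp: Hb_index_def)
  qed
qed

lemma monomial_add: "monomial (m + l) c = monomial m c * prod_list (map (\<lambda>j. X (m + j) ^ c (m + j)) [1..<l + 1])"
  by (induction l) (simp_all add: monomial_Suc mult.assoc)

lemma Theta_mono:
  "t \<le> p \<Longrightarrow> prod_list (concat (map (\<lambda>t. map (\<lambda>j. X (bs b 1 (t - 1) + j) ^ a t j) [1..<b t + 1]) [1..<t + 1]))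
    = monomial (M t) (expo a)"
proof (induction t)
  case (Suc t)
  let ?f = "\<lambda>t. map (\<lambda>j. X (bs b 1 (t - 1) + j) ^ a t j) [1..<b t + 1]"
  have "prod_list (concat (map ?f [1..<Suc t + 1])) = prod_list (concat (map ?f [1..<t + 1])) * prod_list (?f (Suc t))"
    by simp
  also have "prod_list (concat (map ?f [1..<t + 1])) = monomial (M t) (expo a)" using Suc by simp
  also have "?f (Suc t) = map (\<lambda>j. X (M t + j) ^ expo a (M t + j)) [1..<b (Suc t) + 1]"
  proof (rule map_cong[OF refl])
    fix j assume "j \<in> set [1..<b (Suc t) + 1]"
    then have "j \<in> {1..b (Suc t)}" by auto
    then have "expo a (M t + j) = a (Suc t) j" using expo_apply[of "Suc t" j a] Suc.prems by simp
    then show "X (bs b 1 (Suc t - 1) + j) ^ a (Suc t) j = X (M t + j) ^ expo a (M t + j)"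
      by (simp add: M_def)
  qed
  finally show ?case by (simp only: M_Suc monomial_add)
qed simp

text \<open>The new factor moves only points above \<open>M t\<close>, where the product of the
  earlier ones is the identity, so its inversions are left intact.\<close>

lemma Tw_young:
  assumes x: "\<And>t. 1 \<le> t \<Longrightarrow> t \<le> p \<Longrightarrow> x t permutes {1..b t}"
  shows "t \<le> p \<Longrightarrow> prod_list (map (\<lambda>t. Tw T n (shiftp (bs b 1 (t - 1)) (b t) (x t))) [1..<t + 1])
    = Tw T n (young x t)"
proof (induction t)
  case 0
  show ?case unfolding young.simps Tw_id by simp
next
  case (Suc t)
  let ?v = "shiftp (M t) (b (Suc t)) (x (Suc t))"
  let ?g = "\<lambda>t. Tw T n (shiftp (bs b 1 (t - 1)) (b t) (x t))"
  have v: "?v permutes {1..M (Suc t)}" using shf_permutes[OF x, of "Suc t"] Suc.prems by simp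
  have u: "young x t permutes {1..M t}" using young_permutes[OF x, of t] Suc.prems by simp
  have "Tw T n (young x t) * Tw T n ?v = Tw T n (young x t \<circ> ?v)"
  proof (rule Tw_comp)
    show "young x t permutes {1..n}" using permutes_n[OF u] Suc.prems by simp
    show "?v permutes {1..n}" using permutes_n[OF v] Suc.prems by simp
    fix i j :: nat assume ij: "i < j" "?v j < ?v i"
    have low: "?v l = l" if "l \<le> M t" for l using that by (simp add: shiftp_def)
    have blk: "in_block (Suc t) (?v l)" if "in_block (Suc t) l" for l
      using shf_block[OF x, of "Suc t" l] that Suc.prems by simp
    have "M t < i"
    proof (rule ccontr)
      assume i: "\<not> M t < i"
      then have "?v i = i" using low by simp
      then have "?v j \<le> M t" using ij i by simp
      then have "\<not> in_block (Suc t) j" using blk[of j] by (auto simp: in_block_def)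
      then have "?v j = j" using shiftp_fix[of "Suc t" j "x (Suc t)"] by simp
      then show False using ij \<open>?v i = i\<close> by simp
    qed
    then have above: "M t < l \<Longrightarrow> M t < ?v l" for l
      using blk[of l] shiftp_fix[of "Suc t" l "x (Suc t)"] by (cases "in_block (Suc t) l") (auto simp: in_block_def)
    have "M t < ?v i" "M t < ?v j" using above[of i] above[of j] ij \<open>M t < i\<close> by auto
    then show "young x t (?v j) < young x t (?v i)" using permutes_not_in[OF u] ij by simp
  qed
  moreover have "prod_list (map ?g [1..<Suc t + 1]) = prod_list (map ?g [1..<t + 1]) * ?g (Suc t)" by simp
  moreover have "?g (Suc t) = Tw T n ?v" by (simp add: M_def)
  moreover have "prod_list (map ?g [1..<t + 1]) = Tw T n (young x t)"
    by (rule Suc.IH) (use Suc.prems in simp)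
  ultimately show ?case by (simp only: young.simps)
qed

text \<open>\<open>young x p\<close> preserves blocks, so its inversions lie inside single blocks,
  and on each of these \<open>flip p\<close> is increasing. In other words \<open>flip p\<close> is
  a shortest coset representative for the Young subgroup.\<close>

lemma Tw_flip_young:
  assumes x: "\<And>t. 1 \<le> t \<Longrightarrow> t \<le> p \<Longrightarrow> x t permutes {1..b t}"
  shows "Tw T n (flip p) * Tw T n (young x p) = Tw T n (flip p \<circ> young x p)"
proof (rule Tw_comp)
  have y: "young x p permutes {1..n}" using young_permutes[OF x, of p] M_p by simp
  show "flip p permutes {1..n}" using flip_permutes[of p] M_p by simp
  show "young x p permutes {1..n}" by (rule y)
  fix i j assume ij: "i < j" "young x p j < young x p i"
  have "j \<le> n"
  proof (rule ccontr)
    assume c: "\<not> j \<le> n"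
    then have "young x p j = j" using permutes_not_in[OF y] by simp
    then have "young x p i \<notin> {1..n}" using ij c by simp
    then have "young x p i = i" using permutes_in_image[OF y] permutes_not_in[OF y] by blast
    then show False using ij \<open>young x p j = j\<close> by simp
  qed
  have "1 \<le> i"
  proof (rule ccontr)
    assume "\<not> 1 \<le> i"
    then have "young x p i = i" using permutes_not_in[OF y, of i] by simp
    then show False using ij \<open>\<not> 1 \<le> i\<close> by simp
  qed
  then obtain s t where s: "s \<le> p" "in_block s i" and t: "t \<le> p" "in_block t j"
    using in_block_ex[of i p] in_block_ex[of j p] ij \<open>j \<le> n\<close> M_p by auto
  have ys: "in_block s (young x p i)" and yt: "in_block t (young x p j)"
    using young_block[OF x] s t by blast+
  have st: "s = t" using in_block_le[OF s(2) t(2)] in_block_le[OF yt ys] ij by simp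
  have "M (t - 1) < young x p j" using yt by (simp add: in_block_def)
  then show "flip p (young x p j) < flip p (young x p i)"
    using ij(2) unfolding flip_apply[OF ys s(1)] flip_apply[OF yt t(1)] st by linarith
qed

text \<open>A nonzero exponent vector is killed by the reduction, and a nontrivial Young element by
  the trace of T_u T_v. Only the identity basis element remains.\<close>

lemma Tr_Theta_basis:
  assumes ax: "(a, x) \<in> Hb_index p d b"
  shows "Tr (vb \<iota> q T \<epsilon> p d Q n b * Theta_basis \<iota> q T p n b (a, x) * Tb T p n b)
    = (if (a, x) = (\<lambda>t j. 0, \<lambda>t. id) then Tr (vb \<iota> q T \<epsilon> p d Q n b * Tb T p n b) else 0)"
proof -
  have x: "x t permutes {1..b t}" if "1 \<le> t" "t \<le> p" for t
    using ax that by (auto simp: Hb_index_def)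
  obtain K where K: "\<And>c w. (\<forall>j. j \<notin> {1..n} \<longrightarrow> c j = 0) \<Longrightarrow> (\<forall>j. c j < d) \<Longrightarrow> w permutes {1..n} \<Longrightarrow>
    Tr (F p * B * (monomial n c * Tw T n w) * Tb T p n b)
      = (if c = (\<lambda>_. 0) then K * Tr (Tw T n (flip p) * Tw T n w * Tb T p n b) else 0)"
    using Tr_vb_mono_Tw by blast
  have y: "young x p permutes {1..n}" using young_permutes[OF x, of p] M_p by simp
  have fp: "flip p permutes {1..n}" using flip_permutes[of p] M_p by simp
  have up: "unflip (p - 1) permutes {1..n}" by (rule unflip_permutes) simp
  have Th: "Theta_basis \<iota> q T p n b (a, x) = monomial n (expo a) * Tw T n (young x p)"
    using Theta_mono[of p a] Tw_young[OF x, of p] M_p by (simp add: Theta_basis_def)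
  have tr: "Tr (vb \<iota> q T \<epsilon> p d Q n b * Theta_basis \<iota> q T p n b (a, x) * Tb T p n b)
    = (if expo a = (\<lambda>_. 0) then K * Tr (Tw T n (flip p) * Tw T n (young x p) * Tb T p n b) else 0)"
    unfolding Th vb_eq
  proof (rule K[OF _ _ y])
    show "\<forall>j. j \<notin> {1..n} \<longrightarrow> expo a j = 0" by (simp add: expo_def)
    show "\<forall>j. expo a j < d" using ax d1 by (auto simp: expo_def Hb_index_def)
  qed
  consider "expo a \<noteq> (\<lambda>_. 0)" | "young x p \<noteq> id" | "expo a = (\<lambda>_. 0)" "young x p = id" by blast
  then show ?thesis
  proof cases
    case 1
    have "expo (\<lambda>t j. 0) = (\<lambda>_. 0)" by (auto simp: expo_def)
    then show ?thesis using 1 tr by auto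
  next
    case 2
    have fy: "Tw T n (flip p) * Tw T n (young x p) = Tw T n (flip p \<circ> young x p)"
      by (rule Tw_flip_young) (rule x)
    \<comment> \<open>\<open>unflip (p - 1)\<close> is inverse to \<open>flip p\<close>, so this
      composite is a conjugate of \<open>young x p\<close> and is the identity only if
      \<open>young x p\<close> is.\<close>
    have "flip p \<circ> young x p \<circ> unflip (p - 1) \<noteq> id"
    proof
      assume e: "flip p \<circ> young x p \<circ> unflip (p - 1) = id"
      have "young x p (unflip (p - 1) (flip p j)) = unflip (p - 1) (flip p j)" for j
      proof -
        have "unflip (p - 1) (flip p (young x p (unflip (p - 1) (flip p j))))
          = unflip (p - 1) (flip p j)"
          using fun_cong[OF e, of "flip p j"] by simp
        then show ?thesis using fun_cong[OF unflip_flip] by simp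
      qed
      then have "young x p = id" using fun_cong[OF unflip_flip] by (simp add: fun_eq_iff)
      then show False using 2 by simp
    qed
    then have "Tr (Tw T n (flip p) * Tw T n (young x p) * Tb T p n b) = 0"
      unfolding fy Tb_eq by (rule Tr_Tw_Tw[OF permutes_compose[OF y fp] up])
    moreover have "x \<noteq> (\<lambda>t. id)"
    proof
      assume xid: "x = (\<lambda>t. id)"
      have "young x t = id" for t
      proof (induction t)
        case (Suc t)
        have "shiftp k m id = id" for k m by (auto simp: shiftp_def fun_eq_iff)
        then show ?case using Suc xid by (simp only: young.simps id_comp)
      qed (simp only: young.simps)
      then show False using 2 by blast
    qed
    ultimately show ?thesis using tr by simp
  next
    case 3
    have a0: "a = (\<lambda>t j. 0)" using expo_eq_0[OF ax 3(1)] .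
    have "x t = id" for t
    proof (cases "1 \<le> t \<and> t \<le> p")
      case True
      then show ?thesis using young_eq_id[OF x 3(2)] by blast
    next
      case False
      then show ?thesis using ax by (auto simp: Hb_index_def)
    qed
    then have "x = (\<lambda>t. id)" by blast
    \<comment> \<open>The two traces now have the same argument, so \<open>K\<close> need not be
      evaluated.\<close>
    moreover have "Theta_basis \<iota> q T p n b (a, x) = 1"
      unfolding Th 3 by (simp only: monomial_zero Tw_id mult_1_left)
    ultimately show ?thesis using a0 by simp
  qed
qed

lemma Tr_Theta_b:
  "Tr (vb \<iota> q T \<epsilon> p d Q n b * Theta_b \<iota> q T p d n b h * Tb T p n b)
    = Tr_b h * Tr (vb \<iota> q T \<epsilon> p d Q n b * Tb T p n b)"
proof -
  let ?V = "vb \<iota> q T \<epsilon> p d Q n b" and ?W = "Tb T p n b" and ?o = "(\<lambda>t j. 0, \<lambda>t. id)"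
  have o: "?o \<in> Hb_index p d b" using d1 permutes_id by (auto simp: Hb_index_def id_def)
  have "?V * Theta_b \<iota> q T p d n b h * ?W
      = (\<Sum>y\<in>Hb_index p d b. \<iota> (h y) * (?V * Theta_basis \<iota> q T p n b y * ?W))"
    unfolding Theta_b_def sum_distrib_left sum_distrib_right
    by (simp only: mult.assoc iota_left_comm[of ?V])
  then have "Tr (?V * Theta_b \<iota> q T p d n b h * ?W)
      = (\<Sum>y\<in>Hb_index p d b. h y * Tr (?V * Theta_basis \<iota> q T p n b y * ?W))"
    by (simp only: Tr_sum Tr_scale)
  also have "\<dots> = (\<Sum>y\<in>Hb_index p d b. if y = ?o then h y * Tr (?V * ?W) else 0)"
  proof (rule sum.cong[OF refl])
    fix y assume "y \<in> Hb_index p d b"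
    then show "h y * Tr (?V * Theta_basis \<iota> q T p n b y * ?W) = (if y = ?o then h y * Tr (?V * ?W) else 0)"
      using Tr_Theta_basis[of "fst y" "snd y"] by (cases "y = ?o") simp_all
  qed
  also have "\<dots> = h ?o * Tr (?V * ?W)"
    using o by (simp only: sum.delta[OF finite_Hb_index] if_True)
  finally show ?thesis by (simp only: Tr_b_def)
qed

end

theorem theorem2p21:
  fixes \<iota> :: "'r::comm_ring_1 \<Rightarrow> 'a::ring_1"
    and T :: "nat \<Rightarrow> 'a"
    and p d n :: nat and \<epsilon> q :: 'r and Q :: "nat \<Rightarrow> 'r"
    and b :: "nat \<Rightarrow> nat"
    and h :: "((nat \<Rightarrow> nat \<Rightarrow> nat) \<times> (nat \<Rightarrow> nat \<Rightarrow> nat)) \<Rightarrow> 'r"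
  assumes "p > 1" and "d \<ge> 1" and "n \<ge> 3"
    and "primitive_root \<epsilon> p"
    and "unit_el q" and "\<forall>i\<in>{1..d}. unit_el (Q i)"
    and "AK_algebra \<iota> q (AK_params \<epsilon> p d Q) n T"
    and "comp_pn p n b"
  shows "AK_Tr \<iota> q T (p * d) n
            (vb \<iota> q T \<epsilon> p d Q n b * Theta_b \<iota> q T p d n b h * Tb T p n b)
       = Tr_b h * AK_Tr \<iota> q T (p * d) n (vb \<iota> q T \<epsilon> p d Q n b * Tb T p n b)"
proof -
  have "length (AK_params \<epsilon> p d Q) = p * d" by (rule length_AK_params)
  \<comment> \<open>Nonemptiness of the parameter list amounts to \<open>0 < r\<close>, so that the
    zero exponent vector is admissible.\<close>
  then have "AK_params \<epsilon> p d Q \<noteq> []" using assms(1,2) by auto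
  then interpret block_algebra \<iota> q \<epsilon> p d n Q T b
    using assms by unfold_locales auto
  show ?thesis using Tr_Theta_b[of h] unfolding r_eq .
qed

end
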